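(* Let $G$ be a finite group and $H\le G$ a subgroup. The probability $P_{\mathrm{success}}$ that the optimal single-register measurement correctly identifies a uniformly random conjugate of $H$ is $$P_{\mathrm{success}}=\frac{|H|}{|C(H)|}\,\mathrm{Planch}(S_H)\;\le\;\frac{|H|}{|C(H)|\cdot|H_G|}.$$
   Context: $C(H)=\{H^g : g\in G\}$ is the set of conjugates of $H$, where $H^g=g^{-1}Hg$, and $H_G=\bigcap_{g\in G}H^g$ is the largest normal subgroup of $G$ contained in $H$. $\widehat G$ is the set of (isomorphism classes of) irreducible complex representations of $G$ and $d_\sigma$ is the dimension of $\sigma$. $S_H\subseteq\widehat G$ is the set of $\sigma$ for which the projection operator $\pi_H^\sigma=\frac{1}{|H|}\sum_{h\in H}\sigma(h)$ is nonzero. The Plancherel measure of a set $S\subseteq\widehat G$ is $\mathrm{Planch}(S)=\sum_{\sigma\in S}d_\sigma^2/|G|$. Single-register setting: $\mathbb{C}[G]$ is the Hilbert space with orthonormal basis $\{|x\rangle : x\in G\}$. For a conjugate $K\in C(H)$, the coset state is the density matrix $\rho_K=\frac{1}{|G|}\sum_{c\in G}|cK\rangle\langle cK|$ with $|cK\rangle=\frac{1}{\sqrt{|K|}}\sum_{h\in K}|ch\rangle$. A measurement is a family $\{F_K\}_{K\in C(H)}$ of positive semidefinite operators on $\mathbb{C}[G]$ with $\sum_K F_K=\mathbb{1}$ (possibly after adding one extra positive semidefinite operator for an outcome never counted as correct). Its probability of correctly identifying a uniformly random conjugate is $\frac{1}{|C(H)|}\sum_{K\in C(H)}\operatorname{tr}(F_K\rho_K)$,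 and $P_{\mathrm{success}}$ is the maximum of this quantity over all measurements. *)

theory Defs
  imports
    "HOL-Algebra.Coset"
    "Jordan_Normal_Form.VS_Connect"
    "Jordan_Normal_Form.Conjugate"
begin

section \<open>Conjugate subgroups\<close>

definition conj_subgroup :: "('a, 'b) monoid_scheme \<Rightarrow> 'a set \<Rightarrow> 'a \<Rightarrow> 'a set" where
  "conj_subgroup G H g = (inv\<^bsub>G\<^esub> g <#\<^bsub>G\<^esub> H) #>\<^bsub>G\<^esub> g"

definition conjugates :: "('a, 'b) monoid_scheme \<Rightarrow> 'a set \<Rightarrow> 'a set set" where
  "conjugates G H = conj_subgroup G H ` carrier G"

definition normal_core :: "('a, 'b) monoid_scheme \<Rightarrow> 'a set \<Rightarrow> 'a set" where
  "normal_core G H = (\<Inter>g\<in>carrier G. conj_subgroup G H g)"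


section \<open>Irreducible complex representations and Plancherel measure\<close>

text \<open>
  A representation of dimension \<open>d\<close> is a pair \<open>(d, \<sigma>)\<close>, where \<open>\<sigma>\<close> is a homomorphism into
  the group of invertible complex \<open>d \<times> d\<close> matrices, acting on column vectors.
\<close>

type_synonym 'a matrep = "nat \<times> ('a \<Rightarrow> complex mat)"

definition GL :: "nat \<Rightarrow> complex mat monoid" where
  "GL d = units_of (ring_mat TYPE(complex) d ())"

definition invariant_subspace ::
    "('a, 'b) monoid_scheme \<Rightarrow> nat \<Rightarrow> ('a \<Rightarrow> complex mat) \<Rightarrow> complex vec set \<Rightarrow> bool" where
  "invariant_subspace G d \<sigma> W \<longleftrightarrow>
     VectorSpace.subspace class_ring W (module_vec TYPE(complex) d) \<and>
     (\<forall>x\<in>carrier G. \<forall>w\<in>W. \<sigma> x *\<^sub>v w \<in> W)"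

definition irreps :: "('a, 'b) monoid_scheme \<Rightarrow> 'a matrep set" where
  "irreps G = {(d, \<sigma>). \<sigma> \<in> hom G (GL d) \<and> 0 < d \<and>
     (\<forall>W. invariant_subspace G d \<sigma> W \<longrightarrow> W = {0\<^sub>v d} \<or> W = carrier_vec d)}"

text \<open>
  Since \<open>\<sigma>\<close> and \<open>\<tau>\<close> are compared on \<open>carrier G\<close> only, functions differing merely outside the
  carrier lie in the same isomorphism class.
\<close>

definition rep_iso :: "('a, 'b) monoid_scheme \<Rightarrow> ('a matrep \<times> 'a matrep) set" where
  "rep_iso G = {((d, \<sigma>), (e, \<tau>)). (d, \<sigma>) \<in> irreps G \<and> (e, \<tau>) \<in> irreps G \<and> d = e \<and>
     (\<exists>T\<in>carrier (GL d). \<forall>x\<in>carrier G. T * \<sigma> x = \<tau> x * T)}"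

lemma GL_group: "group (GL d)"
proof -
  interpret R: ring "ring_mat TYPE(complex) d ()" by (rule ring_mat)
  show ?thesis unfolding GL_def by (rule R.units_group)
qed

lemma GL_simps:
  "T \<in> carrier (GL d) \<Longrightarrow> T \<in> carrier_mat d d"
  "mult (GL d) = (*)" "one (GL d) = 1\<^sub>m d"
  by (auto simp: GL_def units_of_def Units_def ring_mat_def)

lemma irreps_carrier_mat:
  "(d, \<sigma>) \<in> irreps G \<Longrightarrow> x \<in> carrier G \<Longrightarrow> \<sigma> x \<in> carrier_mat d d"
  by (auto simp: irreps_def hom_def intro!: GL_simps(1))

lemma intertwiner_inverse:
  assumes T: "T \<in> carrier (GL d)" and c: "A \<in> carrier_mat d d" "B \<in> carrier_mat d d"
    and eq: "T * A = B * T"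
  shows "(inv\<^bsub>GL d\<^esub> T) * B = A * (inv\<^bsub>GL d\<^esub> T)"
proof -
  interpret group "GL d" by (rule GL_group)
  let ?S = "inv\<^bsub>GL d\<^esub> T"
  have S: "?S \<in> carrier_mat d d" "T \<in> carrier_mat d d"
    using GL_simps(1)[OF inv_closed[OF T]] GL_simps(1)[OF T] .
  have i: "?S * T = 1\<^sub>m d" "T * ?S = 1\<^sub>m d"
    using l_inv[OF T] r_inv[OF T] by (simp_all add: GL_simps)
  have "?S * B = (?S * B) * (T * ?S)"
    using c S by (simp only: i right_mult_one_mat[OF mult_carrier_mat[OF S(1) c(2)]])
  also have "\<dots> = ((?S * B) * T) * ?S"
    by (rule assoc_mult_mat[OF mult_carrier_mat[OF S(1) c(2)] S(2,1), symmetric])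
  also have "(?S * B) * T = ?S * (T * A)"
    by (simp only: assoc_mult_mat[OF S(1) c(2) S(2)] eq)
  also have "\<dots> = (?S * T) * A"
    by (rule assoc_mult_mat[OF S c(1), symmetric])
  also have "\<dots> = A" by (simp only: i left_mult_one_mat[OF c(1)])
  finally show ?thesis .
qed

lemma rep_isoE:
  assumes "(r, s) \<in> rep_iso G"
  obtains d \<sigma> \<tau> T where "r = (d, \<sigma>)" "s = (d, \<tau>)" "(d, \<sigma>) \<in> irreps G" "(d, \<tau>) \<in> irreps G"
    "T \<in> carrier (GL d)" "\<forall>x\<in>carrier G. T * \<sigma> x = \<tau> x * T"
  using assms unfolding rep_iso_def by blast

lemma rep_isoI:
  assumes "(d, \<sigma>) \<in> irreps G" "(d, \<tau>) \<in> irreps G"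
    "T \<in> carrier (GL d)" "\<And>x. x \<in> carrier G \<Longrightarrow> T * \<sigma> x = \<tau> x * T"
  shows "((d, \<sigma>), (d, \<tau>)) \<in> rep_iso G"
  using assms unfolding rep_iso_def by blast

lemma equiv_rep_iso: "equiv (irreps G) (rep_iso G)"
proof (rule equivI)
  show "rep_iso G \<subseteq> irreps G \<times> irreps G"
    by (auto simp: rep_iso_def)
  show "refl_on (irreps G) (rep_iso G)"
  proof (rule refl_onI)
    fix r assume r: "r \<in> irreps G"
    obtain d \<sigma> where [simp]: "r = (d, \<sigma>)" by (cases r)
    interpret group "GL d" by (rule GL_group)
    have "1\<^sub>m d \<in> carrier (GL d)" using one_closed by (simp add: GL_simps)
    moreover have "1\<^sub>m d * \<sigma> x = \<sigma> x * 1\<^sub>m d" if "x \<in> carrier G" for x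
      using irreps_carrier_mat[of d \<sigma> G x] r that by simp
    ultimately show "(r, r) \<in> rep_iso G"
      using r by (simp add: rep_isoI)
  qed
  show "sym (rep_iso G)"
  proof (rule symI)
    fix r s assume "(r, s) \<in> rep_iso G"
    then obtain d \<sigma> \<tau> T where rs: "r = (d, \<sigma>)" "s = (d, \<tau>)" "(d, \<sigma>) \<in> irreps G" "(d, \<tau>) \<in> irreps G"
      and T: "T \<in> carrier (GL d)" "\<forall>x\<in>carrier G. T * \<sigma> x = \<tau> x * T"
      by (rule rep_isoE)
    interpret group "GL d" by (rule GL_group)
    have "(inv\<^bsub>GL d\<^esub> T) * \<tau> x = \<sigma> x * (inv\<^bsub>GL d\<^esub> T)" if x: "x \<in> carrier G" for x
      by (rule intertwiner_inverse[OF T(1) irreps_carrier_mat[OF rs(3) x]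
            irreps_carrier_mat[OF rs(4) x] bspec[OF T(2) x]])
    then show "(s, r) \<in> rep_iso G"
      unfolding rs(1,2) by (rule rep_isoI[OF rs(4,3) inv_closed[OF T(1)]])
  qed
  show "trans (rep_iso G)"
  proof (rule transI)
    fix r s t assume rs: "(r, s) \<in> rep_iso G" and st: "(s, t) \<in> rep_iso G"
    from rs obtain d \<sigma> \<tau> T where r: "r = (d, \<sigma>)" "s = (d, \<tau>)" "(d, \<sigma>) \<in> irreps G" "(d, \<tau>) \<in> irreps G"
      and T: "T \<in> carrier (GL d)" "\<forall>x\<in>carrier G. T * \<sigma> x = \<tau> x * T"
      by (rule rep_isoE)
    from st obtain \<upsilon> S where t: "t = (d, \<upsilon>)" "(d, \<upsilon>) \<in> irreps G"
      and S: "S \<in> carrier (GL d)" "\<forall>x\<in>carrier G. S * \<tau> x = \<upsilon> x * S"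
      unfolding r(2) rep_iso_def by blast
    interpret group "GL d" by (rule GL_group)
    have "S * T \<in> carrier (GL d)" using m_closed[OF S(1) T(1)] by (simp add: GL_simps)
    moreover have "(S * T) * \<sigma> x = \<upsilon> x * (S * T)" if x: "x \<in> carrier G" for x
    proof -
      have c: "S \<in> carrier_mat d d" "T \<in> carrier_mat d d" "\<sigma> x \<in> carrier_mat d d"
        "\<tau> x \<in> carrier_mat d d" "\<upsilon> x \<in> carrier_mat d d"
        using GL_simps(1)[OF S(1)] GL_simps(1)[OF T(1)]
          irreps_carrier_mat[OF r(3) x] irreps_carrier_mat[OF r(4) x] irreps_carrier_mat[OF t(2) x] .
      have "(S * T) * \<sigma> x = S * (T * \<sigma> x)" by (rule assoc_mult_mat[OF c(1,2,3)])
      also have "T * \<sigma> x = \<tau> x * T" using T(2) x by blast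
      also have "S * (\<tau> x * T) = (S * \<tau> x) * T" by (rule assoc_mult_mat[OF c(1,4,2), symmetric])
      also have "S * \<tau> x = \<upsilon> x * S" using S(2) x by blast
      also have "(\<upsilon> x * S) * T = \<upsilon> x * (S * T)" by (rule assoc_mult_mat[OF c(5,1,2)])
      finally show ?thesis .
    qed
    ultimately show "(r, t) \<in> rep_iso G"
      unfolding r(1) t(1) by (rule rep_isoI[OF r(3) t(2)])
  qed
qed

definition dual :: "('a, 'b) monoid_scheme \<Rightarrow> 'a matrep set set" where
  "dual G = irreps G // rep_iso G"

definition rep_dim :: "'a matrep set \<Rightarrow> nat" where
  "rep_dim C = the_elem (fst ` C)"

lemma rep_dim_eq:
  assumes "C \<in> dual G" and "(d, \<sigma>) \<in> C"
  shows "rep_dim C = d"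
proof -
  have "e = d" if "(e, \<tau>) \<in> C" for e \<tau>
  proof -
    have "((d, \<sigma>), (e, \<tau>)) \<in> rep_iso G"
      using quotient_eq_iff[OF equiv_rep_iso, of C G C "(d, \<sigma>)" "(e, \<tau>)"] assms that
      by (simp add: dual_def)
    then show ?thesis by (rule rep_isoE) simp
  qed
  then have "fst ` C \<subseteq> {d}" by auto
  moreover have "d \<in> fst ` C" using assms(2) by (rule image_eqI[rotated]) simp
  ultimately have "fst ` C = {d}" by blast
  then show ?thesis by (simp add: rep_dim_def)
qed

definition avg_proj :: "'a set \<Rightarrow> 'a matrep \<Rightarrow> complex mat" where
  "avg_proj H = (\<lambda>(d, \<sigma>). mat d d (\<lambda>(i, j). (\<Sum>h\<in>H. \<sigma> h $$ (i, j)) / of_nat (card H)))"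

lemma avg_proj_intertwine:
  assumes H: "H \<subseteq> carrier G" and rep: "(d, \<sigma>) \<in> irreps G" "(d, \<tau>) \<in> irreps G"
    and T: "T \<in> carrier_mat d d" "\<forall>x\<in>carrier G. T * \<sigma> x = \<tau> x * T"
  shows "T * avg_proj H (d, \<sigma>) = avg_proj H (d, \<tau>) * T"
proof (rule eq_matI)
  fix i j assume "i < dim_row (avg_proj H (d, \<tau>) * T)" "j < dim_col (avg_proj H (d, \<tau>) * T)"
  then have ij: "i < d" "j < d" using T(1) by (auto simp: avg_proj_def)
  have e: "(\<Sum>k = 0..<d. T $$ (i, k) * \<sigma> h $$ (k, j)) = (\<Sum>k = 0..<d. \<tau> h $$ (i, k) * T $$ (k, j))"
    if "h \<in> H" for h
  proof -
    have h: "h \<in> carrier G" using that H by auto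
    have c: "\<sigma> h \<in> carrier_mat d d" "\<tau> h \<in> carrier_mat d d"
      using irreps_carrier_mat[OF rep(1) h] irreps_carrier_mat[OF rep(2) h] .
    have "(T * \<sigma> h) $$ (i, j) = (\<tau> h * T) $$ (i, j)" using bspec[OF T(2) h] by (rule arg_cong)
    then show ?thesis using ij c T(1) by (simp add: scalar_prod_def)
  qed
  have "(T * avg_proj H (d, \<sigma>)) $$ (i, j)
      = (\<Sum>k = 0..<d. T $$ (i, k) * ((\<Sum>h\<in>H. \<sigma> h $$ (k, j)) / of_nat (card H)))"
    using ij T(1) by (simp add: avg_proj_def scalar_prod_def)
  also have "\<dots> = (\<Sum>k = 0..<d. \<Sum>h\<in>H. T $$ (i, k) * \<sigma> h $$ (k, j)) / of_nat (card H)"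
    by (simp add: sum_distrib_left sum_divide_distrib)
  also have "\<dots> = (\<Sum>h\<in>H. \<Sum>k = 0..<d. T $$ (i, k) * \<sigma> h $$ (k, j)) / of_nat (card H)"
    by (subst sum.swap) simp
  also have "\<dots> = (\<Sum>h\<in>H. \<Sum>k = 0..<d. \<tau> h $$ (i, k) * T $$ (k, j)) / of_nat (card H)"
    using e by simp
  also have "\<dots> = (\<Sum>k = 0..<d. \<Sum>h\<in>H. \<tau> h $$ (i, k) * T $$ (k, j)) / of_nat (card H)"
    by (subst sum.swap) simp
  also have "\<dots> = (\<Sum>k = 0..<d. ((\<Sum>h\<in>H. \<tau> h $$ (i, k)) / of_nat (card H)) * T $$ (k, j))"
    by (simp add: sum_distrib_right sum_divide_distrib)
  also have "\<dots> = (avg_proj H (d, \<tau>) * T) $$ (i, j)"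
    using ij T(1) by (simp add: avg_proj_def scalar_prod_def)
  finally show "(T * avg_proj H (d, \<sigma>)) $$ (i, j) = (avg_proj H (d, \<tau>) * T) $$ (i, j)" .
qed (use T(1) in \<open>auto simp: avg_proj_def\<close>)

lemma avg_proj_zero_iso:
  assumes H: "H \<subseteq> carrier G" and iso: "((d, \<sigma>), (d, \<tau>)) \<in> rep_iso G"
    and z: "avg_proj H (d, \<tau>) = 0\<^sub>m d d"
  shows "avg_proj H (d, \<sigma>) = 0\<^sub>m d d"
proof -
  interpret group "GL d" by (rule GL_group)
  obtain T where rep: "(d, \<sigma>) \<in> irreps G" "(d, \<tau>) \<in> irreps G"
    and T: "T \<in> carrier (GL d)" "\<forall>x\<in>carrier G. T * \<sigma> x = \<tau> x * T"
    using iso unfolding rep_iso_def by blast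
  let ?S = "inv\<^bsub>GL d\<^esub> T" and ?P = "avg_proj H (d, \<sigma>)"
  have c: "T \<in> carrier_mat d d" "?S \<in> carrier_mat d d" "?P \<in> carrier_mat d d"
    using GL_simps(1)[OF T(1)] GL_simps(1)[OF inv_closed[OF T(1)]] by (simp_all add: avg_proj_def)
  have i: "?S * T = 1\<^sub>m d" using l_inv[OF T(1)] by (simp add: GL_simps)
  have "T * ?P = 0\<^sub>m d d"
    using avg_proj_intertwine[OF H rep c(1) T(2)] z c by simp
  moreover have "?P = ?S * (T * ?P)"
    using assoc_mult_mat[OF c(2,1,3)] c i by simp
  ultimately show ?thesis using c by simp
qed

text \<open>
  By the preceding lemma and symmetry of \<open>rep_iso G\<close>, the condition defining \<open>proj_support\<close>
  does not depend on the representative of \<open>C\<close>.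
\<close>

definition proj_support :: "('a, 'b) monoid_scheme \<Rightarrow> 'a set \<Rightarrow> 'a matrep set set" where
  "proj_support G H =
     {C \<in> dual G. \<exists>(d, \<sigma>)\<in>C. avg_proj H (d, \<sigma>) \<noteq> 0\<^sub>m d d}"

definition planch :: "('a, 'b) monoid_scheme \<Rightarrow> 'a matrep set set \<Rightarrow> real" where
  "planch G S = (\<Sum>C\<in>S. (real (rep_dim C))\<^sup>2 / real (card (carrier G)))"


section \<open>Operators on the group algebra and coset states\<close>

text \<open>
  Vectors and operators on the Hilbert space with orthonormal basis \<open>carrier G\<close> are given by
  their coordinates in that basis: \<open>A x y\<close> is the entry of \<open>A\<close> in row \<open>x\<close> and column \<open>y\<close>.
  Values outside the carrier are irrelevant.
\<close>

type_synonym 'a ket = "'a \<Rightarrow> complex"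
type_synonym 'a oper = "'a \<Rightarrow> 'a \<Rightarrow> complex"

definition basis_ket :: "'a \<Rightarrow> 'a ket" where
  "basis_ket g = (\<lambda>x. if x = g then 1 else 0)"

definition oper_mult :: "('a, 'b) monoid_scheme \<Rightarrow> 'a oper \<Rightarrow> 'a oper \<Rightarrow> 'a oper" where
  "oper_mult G A B = (\<lambda>x y. \<Sum>z\<in>carrier G. A x z * B z y)"

definition oper_trace :: "('a, 'b) monoid_scheme \<Rightarrow> 'a oper \<Rightarrow> complex" where
  "oper_trace G A = (\<Sum>x\<in>carrier G. A x x)"

text \<open>
  In the order on complex numbers, \<open>0 \<le> z\<close> means that \<open>z\<close> is real and nonnegative.
\<close>

definition psd_oper :: "('a, 'b) monoid_scheme \<Rightarrow> 'a oper \<Rightarrow> bool" where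
  "psd_oper G A \<longleftrightarrow>
     (\<forall>v :: 'a ket. 0 \<le> (\<Sum>x\<in>carrier G. \<Sum>y\<in>carrier G. cnj (v x) * A x y * v y))"

definition coset_ket :: "('a, 'b) monoid_scheme \<Rightarrow> 'a \<Rightarrow> 'a set \<Rightarrow> 'a ket" where
  "coset_ket G c K =
     (\<lambda>x. (\<Sum>h\<in>K. basis_ket (c \<otimes>\<^bsub>G\<^esub> h) x) / complex_of_real (sqrt (real (card K))))"

definition coset_state :: "('a, 'b) monoid_scheme \<Rightarrow> 'a set \<Rightarrow> 'a oper" where
  "coset_state G K =
     (\<lambda>x y. (\<Sum>c\<in>carrier G. coset_ket G c K x * cnj (coset_ket G c K y)) / of_nat (card (carrier G)))"


section \<open>Measurements and the optimal success probability\<close>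

text \<open>
  The operator \<open>E\<close> belongs to an outcome never counted as correct; \<open>E = 0\<close> gives the
  measurements whose operators \<open>F K\<close> already sum to the identity.
\<close>

definition measurement ::
    "('a, 'b) monoid_scheme \<Rightarrow> 'a set \<Rightarrow> ('a set \<Rightarrow> 'a oper) \<Rightarrow> bool" where
  "measurement G H F \<longleftrightarrow>
     (\<forall>K\<in>conjugates G H. psd_oper G (F K)) \<and>
     (\<exists>E. psd_oper G E \<and>
       (\<forall>x\<in>carrier G. \<forall>y\<in>carrier G.
          (\<Sum>K\<in>conjugates G H. F K x y) + E x y = (if x = y then 1 else 0)))"

text \<open>The traces are real for every measurement, so taking the real part loses nothing.\<close>

definition success_prob ::
    "('a, 'b) monoid_scheme \<Rightarrow> 'a set \<Rightarrow> ('a set \<Rightarrow> 'a oper) \<Rightarrow> real" where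
  "success_prob G H F =
     (\<Sum>K\<in>conjugates G H. Re (oper_trace G (oper_mult G (F K) (coset_state G K))))
       / real (card (conjugates G H))"

definition P_success :: "('a, 'b) monoid_scheme \<Rightarrow> 'a set \<Rightarrow> real" where
  "P_success G H = (GREATEST p. \<exists>F. measurement G H F \<and> p = success_prob G H F)"

end

theory Submission
  imports Defs "Jordan_Normal_Form.Spectral_Radius"
begin

text \<open>
  The coset state of \<open>K\<close> is \<open>|H| / |G|\<close> times the projection \<open>P\<^sub>K\<close> onto the right
  \<open>K\<close>-invariant functions, which is convolution by the uniform distribution on \<open>K\<close>. Fourier
  inversion writes this distribution as a sum of matrix coefficients of the averages of \<open>K\<close> over
  the \<open>\<sigma>\<close> in \<open>S\<^sub>H\<close>, so all \<open>P\<^sub>K\<close> lie below the projection \<open>\<Pi>\<close> onto the isotypic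
  blocks of \<open>S\<^sub>H\<close>, whose trace is the sum of the \<open>d\<^sub>\<sigma>\<close> squared. Hence the traces of
  \<open>F\<^sub>K P\<^sub>K\<close> sum to at most the trace of \<open>\<Pi>\<close>. By Schur's lemma \<open>M = \<Sum>K. P\<^sub>K\<close> is a positive
  scalar on each block of \<open>S\<^sub>H\<close>, and \<open>F\<^sub>K = M\<^sup>+ P\<^sub>K\<close> attains the bound. Finally, all
  \<open>P\<^sub>K\<close>, and therefore \<open>\<Pi>\<close>, lie below the projection onto the right \<open>H\<^sub>G\<close>-invariant
  functions, of trace \<open>|G| / |H\<^sub>G|\<close>.
\<close>

section \<open>Complex matrices\<close>

text \<open>No \<open>\<sigma>\<close> may be assumed unitary here, so the average of a subgroup
  need not be a Hermitian matrix. Only characters have the right symmetry under inversion, and all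
  positivity is drawn from them. To this end operators are replaced by functions on the group:
  \<open>u\<close> stands for the operator with entries \<open>u (inv x \<otimes> y)\<close>.
  Products become convolutions, orthogonal projections become functions that are
  \<open>hermitian\<close> and \<open>idempotent\<close>, and the trace becomes
  \<open>u \<one>\<close> times the order of the group. For such \<open>u\<close>, the value
  \<open>u \<one>\<close> is the sum of the squared moduli of \<open>u\<close>. This one fact bounds
  the number of classes, shows that a nonzero average has nonzero trace, and gives the final
  inequality. Fourier inversion does not need a full decomposition of the regular representation.
  The unit of convolution minus the sum of all block idempotents is an idempotent class function
  killed by every irreducible representation. Were it nonzero, its convolution operator would fix an
  irreducible subrepresentation, on which it also acts as zero.\<close>

lemma subspace_complex_iff:
  "VectorSpace.subspace class_ring W (module_vec TYPE(complex) d) \<longleftrightarrow>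
     W \<subseteq> carrier_vec d \<and> 0\<^sub>v d \<in> W \<and> (\<forall>v\<in>W. \<forall>w\<in>W. v + w \<in> W) \<and> (\<forall>c. \<forall>v\<in>W. c \<cdot>\<^sub>v v \<in> W)"
proof -
  interpret vec_space "TYPE(complex)" d .
  show ?thesis
    unfolding VectorSpace.subspace_def submodule_def
    using vec_vs vec_module by (auto simp: module_vec_simps)
qed

definition inj_mat :: "complex mat \<Rightarrow> bool" where
  "inj_mat T \<longleftrightarrow> (\<forall>v\<in>carrier_vec (dim_col T). T *\<^sub>v v = 0\<^sub>v (dim_row T) \<longrightarrow> v = 0\<^sub>v (dim_col T))"

lemma inj_matD:
  "inj_mat T \<Longrightarrow> T \<in> carrier_mat e d \<Longrightarrow> v \<in> carrier_vec d \<Longrightarrow> T *\<^sub>v v = 0\<^sub>v e \<Longrightarrow> v = 0\<^sub>v d"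
  unfolding inj_mat_def by auto

lemma inj_matI:
  "T \<in> carrier_mat e d \<Longrightarrow> (\<And>v. v \<in> carrier_vec d \<Longrightarrow> T *\<^sub>v v = 0\<^sub>v e \<Longrightarrow> v = 0\<^sub>v d) \<Longrightarrow> inj_mat T"
  unfolding inj_mat_def by auto

text \<open>For \<open>e < d\<close>, padding \<open>T\<close> with zero rows gives a square matrix
  with vanishing last row. Its determinant is zero, and a kernel vector of it is one of
  \<open>T\<close>.\<close>

lemma inj_mat_cols_le_rows:
  assumes T: "T \<in> carrier_mat e d" and inj: "inj_mat T"
  shows "d \<le> e"
proof (rule ccontr)
  assume "\<not> d \<le> e"
  then have ed: "e < d" by simp
  define M where "M = mat d d (\<lambda>(i, j). if i < e then T $$ (i, j) else 0)"
  have M: "M \<in> carrier_mat d d" by (simp add: M_def)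
  have "M\<^sup>T *\<^sub>v unit_vec d (d - 1) = 0\<^sub>v d"
    using ed by (intro eq_vecI) (auto simp: M_def scalar_prod_right_unit)
  moreover have "unit_vec d (d - 1) \<noteq> (0\<^sub>v d :: complex vec)"
    using ed by simp
  ultimately have "det (M\<^sup>T) = 0"
    using det_0_iff_vec_prod_zero_field[of "M\<^sup>T" d] M unit_vec_carrier by (metis transpose_carrier_mat)
  then have "det M = 0" using det_transpose[OF M] by simp
  then obtain v where v: "v \<in> carrier_vec d" "v \<noteq> 0\<^sub>v d" "M *\<^sub>v v = 0\<^sub>v d"
    using det_0_iff_vec_prod_zero_field[OF M] by blast
  have "T *\<^sub>v v = 0\<^sub>v e"
  proof (rule eq_vecI)
    fix i assume i: "i < dim_vec (0\<^sub>v e :: complex vec)"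
    then have "(T *\<^sub>v v) $ i = (M *\<^sub>v v) $ i"
      using T v(1) ed by (auto simp: M_def scalar_prod_def)
    then show "(T *\<^sub>v v) $ i = 0\<^sub>v e $ i" using v(3) i ed by simp
  qed (use T in auto)
  then show False using inj_matD[OF inj T v(1)] v(2) by simp
qed

text \<open>Preimages of the unit vectors are the columns of a right inverse \<open>R\<close>.
  Having a left inverse, \<open>R\<close> is injective, so the bound for injective matrices applies
  to it.\<close>

lemma surj_mat_rows_le_cols:
  fixes T :: "complex mat"
  assumes T: "T \<in> carrier_mat e d"
    and surj: "\<And>w. w \<in> carrier_vec e \<Longrightarrow> \<exists>v\<in>carrier_vec d. T *\<^sub>v v = w"
  shows "e \<le> d"
proof -
  have "\<exists>v\<in>carrier_vec d. T *\<^sub>v v = unit_vec e j" for j by (rule surj) simp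
  then obtain r where r: "\<And>j. r j \<in> carrier_vec d" "\<And>j. T *\<^sub>v r j = unit_vec e j" by metis
  define R where "R = mat d e (\<lambda>(i, j). r j $ i)"
  have R: "R \<in> carrier_mat d e" by (simp add: R_def)
  have col: "col R j = r j" if "j < e" for j
    using that r(1)[of j] by (intro eq_vecI) (auto simp: R_def)
  have TR: "T * R = 1\<^sub>m e"
  proof (rule eq_matI)
    fix i j assume "i < dim_row (1\<^sub>m e :: complex mat)" "j < dim_col (1\<^sub>m e :: complex mat)"
    then have ij: "i < e" "j < e" by auto
    have "(T * R) $$ (i, j) = (T *\<^sub>v r j) $ i" using ij T R col by simp
    then show "(T * R) $$ (i, j) = 1\<^sub>m e $$ (i, j)" using ij r(2)[of j] by simp
  qed (use T R in auto)
  have "inj_mat R"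
  proof (rule inj_matI[OF R])
    fix v assume v: "v \<in> carrier_vec e" "R *\<^sub>v v = 0\<^sub>v d"
    have "v = (T * R) *\<^sub>v v" using TR v by simp
    also have "\<dots> = T *\<^sub>v (R *\<^sub>v v)" using T R v by simp
    also have "\<dots> = 0\<^sub>v e" using v T by auto
    finally show "v = 0\<^sub>v e" .
  qed
  then show ?thesis by (rule inj_mat_cols_le_rows[OF R])
qed

lemma inj_square_inverse:
  assumes T: "T \<in> carrier_mat d d" and inj: "inj_mat T"
  obtains S where "S \<in> carrier_mat d d" "S * T = 1\<^sub>m d" "T * S = 1\<^sub>m d"
proof -
  have "det T \<noteq> 0"
    using det_0_iff_vec_prod_zero_field[OF T] inj_matD[OF inj T] by blast
  from det_non_zero_imp_unit[OF T this, of "()"]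
  obtain S where "S \<in> carrier_mat d d" "S * T = 1\<^sub>m d" "T * S = 1\<^sub>m d"
    unfolding Units_def ring_mat_def by auto
  then show ?thesis by (rule that)
qed

lemma GL_carrier_iff:
  "T \<in> carrier (GL d) \<longleftrightarrow> T \<in> carrier_mat d d \<and> (\<exists>S\<in>carrier_mat d d. S * T = 1\<^sub>m d \<and> T * S = 1\<^sub>m d)"
  by (auto simp: GL_def units_of_def Units_def ring_mat_def)

lemma mult_mat_vec_index_sum:
  assumes "A \<in> carrier_mat m n" "v \<in> carrier_vec n" "i < m"
  shows "(A *\<^sub>v v) $ i = (\<Sum>k = 0..<n. A $$ (i, k) * v $ k)"
  using assms by (auto simp: scalar_prod_def)

lemma mult_mat_index_sum:
  assumes "A \<in> carrier_mat m n" "B \<in> carrier_mat n p" "i < m" "j < p"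
  shows "(A * B) $$ (i, j) = (\<Sum>k = 0..<n. A $$ (i, k) * B $$ (k, j))"
  using assms by (auto simp: scalar_prod_def)

text \<open>The columns of \<open>T\<close> are a basis of \<open>W\<close>. Choose \<open>k\<close>
  maximal among the injective matrices with range inside \<open>W\<close>; a vector of
  \<open>W\<close> outside the range could be appended as a further column.\<close>

lemma subspace_basis_mat:
  assumes W: "VectorSpace.subspace class_ring W (module_vec TYPE(complex) d)"
  obtains k T where "T \<in> carrier_mat d k" "inj_mat T" "(\<lambda>v. T *\<^sub>v v) ` carrier_vec k = W"
proof -
  note Ws = W[unfolded subspace_complex_iff]
  define P where "P k \<longleftrightarrow> (\<exists>T\<in>carrier_mat d k. inj_mat T \<and> (\<lambda>v. T *\<^sub>v v) ` carrier_vec k \<subseteq> W)" for k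
  have "P 0" unfolding P_def
  proof (intro bexI conjI)
    have z: "(0\<^sub>m d 0 :: complex mat) *\<^sub>v v = 0\<^sub>v d" if "v \<in> carrier_vec 0" for v
      using that by (intro eq_vecI) (auto simp: scalar_prod_def)
    show "inj_mat (0\<^sub>m d 0)" by (rule inj_matI[of _ d 0]) auto
    show "(\<lambda>v. (0\<^sub>m d 0 :: complex mat) *\<^sub>v v) ` carrier_vec 0 \<subseteq> W"
      using Ws z by auto
  qed simp
  moreover have bnd: "\<And>k. P k \<Longrightarrow> k \<le> d"
    unfolding P_def using inj_mat_cols_le_rows by blast
  ultimately obtain k where k: "P k" "\<And>l. P l \<Longrightarrow> l \<le> k"
    using Greatest_le_nat[of P _ d] GreatestI_nat[of P 0 d] by blast
  then obtain T where T: "T \<in> carrier_mat d k" "inj_mat T" "(\<lambda>v. T *\<^sub>v v) ` carrier_vec k \<subseteq> W"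
    unfolding P_def by blast
  have "W \<subseteq> (\<lambda>v. T *\<^sub>v v) ` carrier_vec k"
  proof (rule ccontr)
    assume "\<not> ?thesis"
    then obtain w where w: "w \<in> W" "\<And>v. v \<in> carrier_vec k \<Longrightarrow> T *\<^sub>v v \<noteq> w" by blast
    have wd: "w \<in> carrier_vec d" using w Ws by blast
    define T' where "T' = mat d (Suc k) (\<lambda>(i, j). if j < k then T $$ (i, j) else w $ i)"
    have T': "T' \<in> carrier_mat d (Suc k)" by (simp add: T'_def)
    have eq: "T' *\<^sub>v v = T *\<^sub>v vec k (($) v) + v $ k \<cdot>\<^sub>v w" if v: "v \<in> carrier_vec (Suc k)" for v
      using T(1) wd v by (intro eq_vecI) (auto simp: T'_def scalar_prod_def)
    have "inj_mat T'"
    proof (rule inj_matI[OF T'])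
      fix v assume v: "v \<in> carrier_vec (Suc k)" "T' *\<^sub>v v = 0\<^sub>v d"
      let ?u = "vec k (($) v)"
      have Tu: "T *\<^sub>v ?u \<in> carrier_vec d" using T(1) by auto
      have z: "T *\<^sub>v ?u + v $ k \<cdot>\<^sub>v w = 0\<^sub>v d" using eq v by simp
      \<comment> \<open>Otherwise the relation could be solved for \<open>w\<close>, placing it in
        the range of \<open>T\<close>.\<close>
      have vk: "v $ k = 0"
      proof (rule ccontr)
        assume nz: "v $ k \<noteq> 0"
        have "T *\<^sub>v ((- 1 / v $ k) \<cdot>\<^sub>v ?u) = (- 1 / v $ k) \<cdot>\<^sub>v (T *\<^sub>v ?u)"
          using T(1) by (intro mult_mat_vec) auto
        also have "\<dots> = w"
        proof (rule eq_vecI)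
          fix i assume i: "i < dim_vec w"
          have "(T *\<^sub>v ?u + v $ k \<cdot>\<^sub>v w) $ i = 0" using z i wd by simp
          then have "(T *\<^sub>v ?u) $ i = - (v $ k * w $ i)" 
            using i wd Tu by (simp add: eq_neg_iff_add_eq_0 del: index_mult_mat_vec)
          then show "((- 1 / v $ k) \<cdot>\<^sub>v (T *\<^sub>v ?u)) $ i = w $ i"
            using i wd T(1) nz by (simp del: index_mult_mat_vec)
        qed (use wd T(1) in auto)
        finally show False using w(2)[of "(- 1 / v $ k) \<cdot>\<^sub>v ?u"] by simp
      qed
      have "T *\<^sub>v ?u = 0\<^sub>v d"
      proof (rule eq_vecI)
        fix i assume i: "i < dim_vec (0\<^sub>v d :: complex vec)"
        have "(T *\<^sub>v ?u + v $ k \<cdot>\<^sub>v w) $ i = 0" using z i by simp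
        then show "(T *\<^sub>v ?u) $ i = 0\<^sub>v d $ i"
          using vk i wd T(1) by (simp del: index_mult_mat_vec)
      qed (use T(1) in auto)
      then have u0: "?u = 0\<^sub>v k" by (intro inj_matD[OF T(2,1)]) auto
      show "v = 0\<^sub>v (Suc k)"
      proof (rule eq_vecI)
        fix i assume "i < dim_vec (0\<^sub>v (Suc k) :: complex vec)"
        then show "v $ i = 0\<^sub>v (Suc k) $ i"
          using vk arg_cong[OF u0, of "\<lambda>x. x $ i"] by (cases "i = k") auto
      qed (use v in auto)
    qed
    moreover have "T' *\<^sub>v v \<in> W" if v: "v \<in> carrier_vec (Suc k)" for v
    proof -
      have "T *\<^sub>v vec k (($) v) \<in> W" using T(3) vec_carrier by blast
      then show ?thesis unfolding eq[OF v] using Ws w(1) by blast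
    qed
    ultimately have "P (Suc k)" unfolding P_def using T' by blast
    then show False using k(2) by fastforce
  qed
  then show ?thesis using that T by blast
qed

lemma inj_mat_mult:
  assumes A: "A \<in> carrier_mat n k" "inj_mat A" and B: "B \<in> carrier_mat k m" "inj_mat B"
  shows "inj_mat (A * B)"
proof (rule inj_matI[OF mult_carrier_mat[OF A(1) B(1)]])
  fix v assume v: "v \<in> carrier_vec m" "A * B *\<^sub>v v = 0\<^sub>v n"
  then have "A *\<^sub>v (B *\<^sub>v v) = 0\<^sub>v n" using A B by simp
  then have "B *\<^sub>v v = 0\<^sub>v k" using inj_matD[OF A(2,1) mult_mat_vec_carrier[OF B(1) v(1)]] by simp
  then show "v = 0\<^sub>v m" by (rule inj_matD[OF B(2,1) v(1)])
qed

lemma inj_mat_cancel: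
  assumes T: "T \<in> carrier_mat n k" "inj_mat T" and A: "A \<in> carrier_mat k m" and B: "B \<in> carrier_mat k m"
    and eq: "T * A = T * B"
  shows "A = B"
proof (rule eq_matI)
  fix i j assume ij: "i < dim_row B" "j < dim_col B"
  have "T *\<^sub>v (col A j - col B j) = T *\<^sub>v col A j - T *\<^sub>v col B j"
    using ij A B T by (intro mult_minus_distrib_mat_vec) auto
  also have "T *\<^sub>v col A j = T *\<^sub>v col B j"
    using ij B col_mult2[OF T(1) A, of j] col_mult2[OF T(1) B, of j] eq by simp
  also have "\<dots> - \<dots> = 0\<^sub>v n" using T by (intro minus_cancel_vec) (auto intro!: carrier_vecI)
  finally have "col A j - col B j = 0\<^sub>v k"
    using ij A B by (intro inj_matD[OF T(2,1)]) auto
  then have "(col A j - col B j) $ i = 0\<^sub>v k $ i" by simp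
  then show "A $$ (i, j) = B $$ (i, j)" using ij A B by simp
qed (use A B in auto)

text \<open>This reads off the matrices by which a representation acts on an invariant
  range.\<close>

lemma mat_factor_through_range:
  fixes T M :: "complex mat"
  assumes T: "T \<in> carrier_mat n k" and M: "M \<in> carrier_mat n m"
    and range: "\<And>v. v \<in> carrier_vec m \<Longrightarrow> M *\<^sub>v v \<in> (\<lambda>v. T *\<^sub>v v) ` carrier_vec k"
  obtains s where "s \<in> carrier_mat k m" "M = T * s"
proof -
  have "\<exists>u\<in>carrier_vec k. M *\<^sub>v unit_vec m j = T *\<^sub>v u" for j
    using range[OF unit_vec_carrier] by blast
  then obtain u where u: "\<And>j. u j \<in> carrier_vec k" "\<And>j. M *\<^sub>v unit_vec m j = T *\<^sub>v u j" by metis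
  define s where "s = mat k m (\<lambda>(i, j). u j $ i)"
  have s: "s \<in> carrier_mat k m" by (simp add: s_def)
  have "M = T * s"
  proof (rule eq_matI)
    fix i j assume "i < dim_row (T * s)" "j < dim_col (T * s)"
    then have ij: "i < n" "j < m" using T s by auto
    have col: "col s j = u j"
      using ij u(1)[of j] by (intro eq_vecI) (auto simp: s_def)
    have "M $$ (i, j) = (M *\<^sub>v unit_vec m j) $ i" using ij M by (simp add: scalar_prod_right_unit)
    also have "\<dots> = (T * s) $$ (i, j)" using ij T s col by (simp add: u(2))
    finally show "M $$ (i, j) = (T * s) $$ (i, j)" .
  qed (use T M s in auto)
  then show ?thesis using that s by blast
qed

section \<open>Representations of a finite group\<close>

locale finite_group = group G for G (structure) +
  assumes finite_carrier: "finite (carrier G)"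
begin

lemma sum_mult_left: "x \<in> carrier G \<Longrightarrow> (\<Sum>g\<in>carrier G. f (x \<otimes> g)) = (\<Sum>g\<in>carrier G. f g)"
  by (rule sum.reindex_bij_witness[of _ "\<lambda>g. inv x \<otimes> g" "\<lambda>g. x \<otimes> g"]) (auto simp: m_assoc[symmetric])

lemma sum_mult_right: "x \<in> carrier G \<Longrightarrow> (\<Sum>g\<in>carrier G. f (g \<otimes> x)) = (\<Sum>g\<in>carrier G. f g)"
  by (rule sum.reindex_bij_witness[of _ "\<lambda>g. g \<otimes> inv x" "\<lambda>g. g \<otimes> x"]) (auto simp: m_assoc)

lemma sum_inv: "(\<Sum>g\<in>carrier G. f (inv g)) = (\<Sum>g\<in>carrier G. f g)"
  by (rule sum.reindex_bij_witness[of _ "\<lambda>g. inv g" "\<lambda>g. inv g"]) auto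

text \<open>Invertibility follows from the remaining conditions (\<open>rep_hom_GL\<close>). Leaving
  it out makes restrictions and the regular representation quick to check.\<close>

definition rep :: "nat \<Rightarrow> ('a \<Rightarrow> complex mat) \<Rightarrow> bool" where
  "rep d \<sigma> \<longleftrightarrow> (\<forall>x\<in>carrier G. \<sigma> x \<in> carrier_mat d d) \<and>
     (\<forall>x\<in>carrier G. \<forall>y\<in>carrier G. \<sigma> (x \<otimes> y) = \<sigma> x * \<sigma> y) \<and> \<sigma> \<one> = 1\<^sub>m d"

lemma rep_carrier: "rep d \<sigma> \<Longrightarrow> x \<in> carrier G \<Longrightarrow> \<sigma> x \<in> carrier_mat d d"
  and rep_mult: "rep d \<sigma> \<Longrightarrow> x \<in> carrier G \<Longrightarrow> y \<in> carrier G \<Longrightarrow> \<sigma> (x \<otimes> y) = \<sigma> x * \<sigma> y"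
  and rep_one: "rep d \<sigma> \<Longrightarrow> \<sigma> \<one> = 1\<^sub>m d"
  by (auto simp: rep_def)

lemma rep_mult_index:
  assumes "rep d \<sigma>" "x \<in> carrier G" "y \<in> carrier G" "i < d" "j < d"
  shows "\<sigma> (x \<otimes> y) $$ (i, j) = (\<Sum>k = 0..<d. \<sigma> x $$ (i, k) * \<sigma> y $$ (k, j))"
  using assms by (simp add: rep_mult mult_mat_index_sum[OF rep_carrier rep_carrier])

lemma rep_hom_GL: "rep d \<sigma> \<longleftrightarrow> \<sigma> \<in> hom G (GL d)"
proof
  assume r: "rep d \<sigma>"
  have "\<sigma> x \<in> carrier (GL d)" if x: "x \<in> carrier G" for x
    unfolding GL_carrier_iff
    using x rep_mult[OF r, of "inv x" x] rep_mult[OF r, of x "inv x"] rep_one[OF r] rep_carrier[OF r]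
    by (auto intro!: bexI[of _ "\<sigma> (inv x)"])
  then show "\<sigma> \<in> hom G (GL d)"
    by (auto simp: hom_def GL_simps rep_mult[OF r])
next
  assume h: "\<sigma> \<in> hom G (GL d)"
  interpret GL: group "GL d" by (rule GL_group)
  have "\<sigma> \<one> = 1\<^sub>m d"
    using hom_one[OF h is_group GL_group] by (simp add: GL_simps)
  moreover have "\<sigma> x \<in> carrier_mat d d" if "x \<in> carrier G" for x
    using h that by (auto simp: hom_def intro!: GL_simps(1))
  moreover have "\<sigma> (x \<otimes> y) = \<sigma> x * \<sigma> y" if "x \<in> carrier G" "y \<in> carrier G" for x y
    using h that by (simp add: hom_mult GL_simps(2))
  ultimately show "rep d \<sigma>" by (simp add: rep_def)
qed

lemma irreps_rep: "(d, \<sigma>) \<in> irreps G \<Longrightarrow> rep d \<sigma>"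
  and irreps_dim_pos: "(d, \<sigma>) \<in> irreps G \<Longrightarrow> 0 < d"
  by (auto simp: irreps_def rep_hom_GL)

lemma irreps_invariant_subspace:
  assumes "(d, \<sigma>) \<in> irreps G" "W \<subseteq> carrier_vec d" "0\<^sub>v d \<in> W"
    "\<And>v w. v \<in> W \<Longrightarrow> w \<in> W \<Longrightarrow> v + w \<in> W" "\<And>c v. v \<in> W \<Longrightarrow> c \<cdot>\<^sub>v v \<in> W"
    "\<And>x v. x \<in> carrier G \<Longrightarrow> v \<in> W \<Longrightarrow> \<sigma> x *\<^sub>v v \<in> W"
  shows "W = {0\<^sub>v d} \<or> W = carrier_vec d"
proof -
  have "invariant_subspace G d \<sigma> W"
    unfolding invariant_subspace_def subspace_complex_iff using assms(2-6) by simp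
  then show ?thesis using assms(1) by (simp add: irreps_def)
qed

text \<open>The kernel of an intertwiner is invariant, and it is not the whole space because
  \<open>T\<close> is nonzero. Irreducibility is asked of the source only.\<close>

lemma intertwiner_inj:
  assumes \<sigma>: "(d, \<sigma>) \<in> irreps G" and \<tau>: "rep e \<tau>" and T: "T \<in> carrier_mat e d"
    and eq: "\<And>x. x \<in> carrier G \<Longrightarrow> T * \<sigma> x = \<tau> x * T" and nz: "T \<noteq> 0\<^sub>m e d"
  shows "inj_mat T"
proof -
  note r = irreps_rep[OF \<sigma>]
  let ?W = "{v \<in> carrier_vec d. T *\<^sub>v v = 0\<^sub>v e}"
  have "?W = {0\<^sub>v d} \<or> ?W = carrier_vec d"
  proof (rule irreps_invariant_subspace[OF \<sigma>])
    fix x v assume x: "x \<in> carrier G" and v: "v \<in> ?W"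
    have "T *\<^sub>v (\<sigma> x *\<^sub>v v) = (T * \<sigma> x) *\<^sub>v v"
      using T rep_carrier[OF r x] v by simp
    also have "\<dots> = \<tau> x *\<^sub>v (T *\<^sub>v v)"
      unfolding eq[OF x] using T rep_carrier[OF \<tau> x] v by simp
    also have "\<dots> = 0\<^sub>v e" using v rep_carrier[OF \<tau> x] by auto
    finally show "\<sigma> x *\<^sub>v v \<in> ?W" using rep_carrier[OF r x] v by auto
  qed (use T in \<open>auto simp: mult_add_distrib_mat_vec mult_mat_vec\<close>)
  moreover have "?W \<noteq> carrier_vec d"
  proof
    assume W: "?W = carrier_vec d"
    have "T = 0\<^sub>m e d"
    proof (rule eq_matI)
      fix i j assume ij: "i < dim_row (0\<^sub>m e d :: complex mat)" "j < dim_col (0\<^sub>m e d :: complex mat)"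
      have "unit_vec d j \<in> ?W" unfolding W by simp
      then have "(T *\<^sub>v unit_vec d j) $ i = 0" using ij by simp
      then show "T $$ (i, j) = 0\<^sub>m e d $$ (i, j)" using ij T by (simp add: scalar_prod_right_unit)
    qed (use T in auto)
    then show False using nz by simp
  qed
  ultimately have "?W = {0\<^sub>v d}" by blast
  then show ?thesis by (intro inj_matI[OF T]) blast
qed

text \<open>Dual to the kernel argument: the range is invariant and nonzero, with irreducibility
  asked of the target only.\<close>

lemma intertwiner_surj:
  assumes \<sigma>: "rep d \<sigma>" and \<tau>: "(e, \<tau>) \<in> irreps G" and T: "T \<in> carrier_mat e d"
    and eq: "\<And>x. x \<in> carrier G \<Longrightarrow> T * \<sigma> x = \<tau> x * T" and nz: "T \<noteq> 0\<^sub>m e d"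
    and w: "w \<in> carrier_vec e"
  shows "\<exists>v\<in>carrier_vec d. T *\<^sub>v v = w"
proof -
  note r = irreps_rep[OF \<tau>]
  let ?W = "(\<lambda>v. T *\<^sub>v v) ` carrier_vec d"
  have "?W = {0\<^sub>v e} \<or> ?W = carrier_vec e"
  proof (rule irreps_invariant_subspace[OF \<tau>])
    have "T *\<^sub>v 0\<^sub>v d = 0\<^sub>v e" using T by auto
    then show "0\<^sub>v e \<in> ?W" by (metis imageI zero_carrier_vec)
    fix c v w
    assume v: "v \<in> ?W"
    then obtain v' where v': "v = T *\<^sub>v v'" "v' \<in> carrier_vec d" by blast
    show "c \<cdot>\<^sub>v v \<in> ?W" using v' mult_mat_vec[OF T v'(2), of c]
      by (metis imageI smult_carrier_vec)
    show "\<tau> x *\<^sub>v v \<in> ?W" if x: "x \<in> carrier G" for x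
    proof -
      have "\<tau> x *\<^sub>v v = (\<tau> x * T) *\<^sub>v v'" using v' T rep_carrier[OF r x] by simp
      also have "\<dots> = T *\<^sub>v (\<sigma> x *\<^sub>v v')"
        unfolding eq[OF x, symmetric] using v' T rep_carrier[OF \<sigma> x] by simp
      finally show ?thesis using v' rep_carrier[OF \<sigma> x] by auto
    qed
    assume "w \<in> ?W"
    then obtain w' where w': "w = T *\<^sub>v w'" "w' \<in> carrier_vec d" by blast
    show "v + w \<in> ?W" 
      using v' w' mult_add_distrib_mat_vec[OF T v'(2) w'(2)]
      by (metis add_carrier_vec imageI)
  qed (use T in auto)
  moreover have "?W \<noteq> {0\<^sub>v e}"
  proof
    assume W: "?W = {0\<^sub>v e}"
    have "T = 0\<^sub>m e d"
    proof (rule eq_matI)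
      fix i j assume ij: "i < dim_row (0\<^sub>m e d :: complex mat)" "j < dim_col (0\<^sub>m e d :: complex mat)"
      have "T *\<^sub>v unit_vec d j \<in> ?W" by simp
      then have "(T *\<^sub>v unit_vec d j) $ i = 0" unfolding W using ij by simp
      then show "T $$ (i, j) = 0\<^sub>m e d $$ (i, j)" using ij T by (simp add: scalar_prod_right_unit)
    qed (use T in auto)
    then show False using nz by simp
  qed
  ultimately have "?W = carrier_vec e" by blast
  then show ?thesis using w by (metis imageE)
qed

text \<open>The dimensions are not known to agree beforehand: injectivity gives
  \<open>d \<le> e\<close>, surjectivity \<open>e \<le> d\<close>.\<close>

lemma schur_iso:
  assumes \<sigma>: "(d, \<sigma>) \<in> irreps G" and \<tau>: "(e, \<tau>) \<in> irreps G" and T: "T \<in> carrier_mat e d"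
    and eq: "\<And>x. x \<in> carrier G \<Longrightarrow> T * \<sigma> x = \<tau> x * T" and nz: "T \<noteq> 0\<^sub>m e d"
  shows "((d, \<sigma>), (e, \<tau>)) \<in> rep_iso G"
proof -
  have inj: "inj_mat T" by (rule intertwiner_inj[OF \<sigma> irreps_rep[OF \<tau>] T eq nz])
  have "e \<le> d"
    by (rule surj_mat_rows_le_cols[OF T intertwiner_surj[OF irreps_rep[OF \<sigma>] \<tau> T eq nz]])
  with inj_mat_cols_le_rows[OF T inj] have de: "e = d" by simp
  obtain S where "S \<in> carrier_mat d d" "S * T = 1\<^sub>m d" "T * S = 1\<^sub>m d"
    using inj_square_inverse[OF T[unfolded de] inj] .
  then have "T \<in> carrier (GL d)"
    unfolding GL_carrier_iff using T de by blast
  then show ?thesis using \<sigma> \<tau> eq unfolding de by (intro rep_isoI)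
qed

text \<open>Subtracting an eigenvalue from \<open>T\<close> gives an intertwiner with nontrivial
  kernel, which must vanish. An eigenvalue exists because the field is complex and \<open>d\<close>
  is positive.\<close>

lemma schur_scalar:
  assumes \<sigma>: "(d, \<sigma>) \<in> irreps G" and T: "T \<in> carrier_mat d d"
    and eq: "\<And>x. x \<in> carrier G \<Longrightarrow> T * \<sigma> x = \<sigma> x * T"
  obtains c where "T = c \<cdot>\<^sub>m 1\<^sub>m d"
proof -
  note r = irreps_rep[OF \<sigma>]
  obtain c v where cv: "eigenvector T v c"
    using spectrum_non_empty[OF T irreps_dim_pos[OF \<sigma>]] unfolding spectrum_def eigenvalue_def by blast
  then have v: "v \<in> carrier_vec d" "v \<noteq> 0\<^sub>v d" "T *\<^sub>v v = c \<cdot>\<^sub>v v"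
    using T by (auto simp: eigenvector_def)
  let ?U = "T - c \<cdot>\<^sub>m 1\<^sub>m d"
  have U: "?U \<in> carrier_mat d d" using T by auto
  have "?U *\<^sub>v v = 0\<^sub>v d"
  proof (rule eq_vecI)
    fix i assume "i < dim_vec (0\<^sub>v d :: complex vec)"
    then have i: "i < d" by simp
    have "(?U *\<^sub>v v) $ i = (\<Sum>k = 0..<d. T $$ (i, k) * v $ k) - (\<Sum>k = 0..<d. if k = i then c * v $ k else 0)"
      unfolding mult_mat_vec_index_sum[OF U v(1) i] sum_subtractf[symmetric]
      using i T by (intro sum.cong) (auto simp: left_diff_distrib)
    also have "\<dots> = (T *\<^sub>v v) $ i - c * v $ i"
      using i by (simp add: mult_mat_vec_index_sum[OF T v(1)] del: index_mult_mat_vec)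
    also have "\<dots> = 0" using v i by (simp del: index_mult_mat_vec)
    finally show "(?U *\<^sub>v v) $ i = 0\<^sub>v d $ i" using i by simp
  qed (use T in auto)
  then have not_inj: "\<not> inj_mat ?U" using v inj_matD[OF _ U] by blast
  have comm: "?U * \<sigma> x = \<sigma> x * ?U" if x: "x \<in> carrier G" for x
  proof -
    have s: "\<sigma> x \<in> carrier_mat d d" by (rule rep_carrier[OF r x])
    have "?U * \<sigma> x = T * \<sigma> x - c \<cdot>\<^sub>m \<sigma> x"
      using s T by (simp add: minus_mult_distrib_mat[of _ d d] mult_smult_assoc_mat[of _ d d])
    also have "\<dots> = \<sigma> x * ?U"
      unfolding mult_minus_distrib_mat[OF s T smult_carrier_mat[OF one_carrier_mat]]
        mult_smult_distrib[OF s one_carrier_mat] eq[OF x] using s by simp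
    finally show ?thesis .
  qed
  have U0: "?U = 0\<^sub>m d d"
  proof (rule ccontr)
    assume nz: "?U \<noteq> 0\<^sub>m d d"
    show False using intertwiner_inj[OF \<sigma> r U comm nz] not_inj by simp
  qed
  have "T = c \<cdot>\<^sub>m 1\<^sub>m d"
  proof (rule eq_matI)
    fix i j assume "i < dim_row (c \<cdot>\<^sub>m 1\<^sub>m d)" "j < dim_col (c \<cdot>\<^sub>m 1\<^sub>m d)"
    then have "i < d" "j < d" by auto
    moreover have "?U $$ (i, j) = 0\<^sub>m d d $$ (i, j)" by (simp only: U0)
    ultimately show "T $$ (i, j) = (c \<cdot>\<^sub>m 1\<^sub>m d) $$ (i, j)" using T by simp
  qed (use T in auto)
  then show ?thesis by (rule that)
qed

text \<open>\<open>M\<close> is the sum over \<open>g\<close> of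
  \<open>\<sigma> g * E * \<tau> (inv g)\<close>, where \<open>E\<close> is the matrix unit in row
  \<open>j\<close> and column \<open>k\<close>. Translating \<open>g\<close> by \<open>x\<close>
  moves \<open>\<sigma> x\<close> on the left to \<open>\<tau> x\<close> on the right.\<close>

lemma matrix_unit_average_intertwines:
  assumes \<sigma>: "rep d \<sigma>" and \<tau>: "rep e \<tau>" and jk: "j < d" "k < e" and x: "x \<in> carrier G"
  defines "M \<equiv> mat d e (\<lambda>(i, l). \<Sum>g\<in>carrier G. \<sigma> g $$ (i, j) * \<tau> (inv g) $$ (k, l))"
  shows "M * \<tau> x = \<sigma> x * M"
proof (rule eq_matI)
  have M: "M \<in> carrier_mat d e" by (simp add: M_def)
  note c = rep_carrier[OF \<sigma> x] rep_carrier[OF \<tau> x]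
  fix i l assume "i < dim_row (\<sigma> x * M)" "l < dim_col (\<sigma> x * M)"
  then have il: "i < d" "l < e" using M c by auto
  have "(\<sigma> x * M) $$ (i, l)
      = (\<Sum>m = 0..<d. \<sigma> x $$ (i, m) * (\<Sum>g\<in>carrier G. \<sigma> g $$ (m, j) * \<tau> (inv g) $$ (k, l)))"
    using il by (simp add: mult_mat_index_sum[OF c(1) M]) (simp add: M_def)
  also have "\<dots> = (\<Sum>g\<in>carrier G. (\<Sum>m = 0..<d. \<sigma> x $$ (i, m) * \<sigma> g $$ (m, j)) * \<tau> (inv g) $$ (k, l))"
    by (subst sum_distrib_right, subst sum.swap) (simp add: sum_distrib_left mult.assoc)
  also have "\<dots> = (\<Sum>g\<in>carrier G. \<sigma> (x \<otimes> g) $$ (i, j) * \<tau> (inv g) $$ (k, l))"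
    using il jk x by (simp add: rep_mult_index[OF \<sigma>])
  \<comment> \<open>Now \<open>g\<close> occurs only through \<open>x \<otimes> g\<close>, so the
    sum can be translated.\<close>
  also have "\<dots> = (\<Sum>g\<in>carrier G. \<sigma> (x \<otimes> g) $$ (i, j) * \<tau> (inv (x \<otimes> g) \<otimes> x) $$ (k, l))"
    using x by (intro sum.cong) (simp_all add: inv_mult_group m_assoc)
  also have "\<dots> = (\<Sum>g\<in>carrier G. \<sigma> g $$ (i, j) * \<tau> (inv g \<otimes> x) $$ (k, l))"
    by (rule sum_mult_left[OF x])
  also have "\<dots> = (\<Sum>g\<in>carrier G. \<Sum>m = 0..<e. \<sigma> g $$ (i, j) * \<tau> (inv g) $$ (k, m) * \<tau> x $$ (m, l))"
    using il jk x by (simp add: rep_mult_index[OF \<tau>] sum_distrib_left mult.assoc)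
  also have "\<dots> = (\<Sum>m = 0..<e. (\<Sum>g\<in>carrier G. \<sigma> g $$ (i, j) * \<tau> (inv g) $$ (k, m)) * \<tau> x $$ (m, l))"
    by (subst sum.swap) (simp add: sum_distrib_right)
  also have "\<dots> = (M * \<tau> x) $$ (i, l)"
    using il by (simp add: mult_mat_index_sum[OF M c(2)]) (simp add: M_def)
  finally show "(M * \<tau> x) $$ (i, l) = (\<sigma> x * M) $$ (i, l)" by simp
qed (use rep_carrier[OF \<sigma> x] rep_carrier[OF \<tau> x] in \<open>auto simp: M_def\<close>)

lemma schur_orthogonality_distinct:
  assumes \<sigma>: "(d, \<sigma>) \<in> irreps G" and \<tau>: "(e, \<tau>) \<in> irreps G"
    and non_iso: "((e, \<tau>), (d, \<sigma>)) \<notin> rep_iso G" and ij: "i < d" "j < d" and kl: "k < e" "l < e"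
  shows "(\<Sum>g\<in>carrier G. \<sigma> g $$ (i, j) * \<tau> (inv g) $$ (k, l)) = 0"
proof -
  let ?M = "mat d e (\<lambda>(i, l). \<Sum>g\<in>carrier G. \<sigma> g $$ (i, j) * \<tau> (inv g) $$ (k, l))"
  have "?M = 0\<^sub>m d e"
    using schur_iso[OF \<tau> \<sigma>, of ?M] non_iso
      matrix_unit_average_intertwines[OF irreps_rep[OF \<sigma>] irreps_rep[OF \<tau>] ij(2) kl(1)]
    by auto
  then have "?M $$ (i, l) = 0\<^sub>m d e $$ (i, l)" by (rule arg_cong)
  then show ?thesis using ij kl by simp
qed

lemma schur_orthogonality_same:
  assumes \<sigma>: "(d, \<sigma>) \<in> irreps G" and ij: "i < d" "j < d" and kl: "k < d" "l < d"
  shows "(\<Sum>g\<in>carrier G. \<sigma> g $$ (i, j) * \<sigma> (inv g) $$ (k, l)) =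
     (if j = k \<and> i = l then of_nat (card (carrier G)) / of_nat d else 0)"
proof -
  note r = irreps_rep[OF \<sigma>]
  let ?M = "mat d d (\<lambda>(i, l). \<Sum>g\<in>carrier G. \<sigma> g $$ (i, j) * \<sigma> (inv g) $$ (k, l))"
  obtain c where c: "?M = c \<cdot>\<^sub>m 1\<^sub>m d"
    using schur_scalar[OF \<sigma>, of ?M] matrix_unit_average_intertwines[OF r r ij(2) kl(1)] by auto
  have entry: "(\<Sum>g\<in>carrier G. \<sigma> g $$ (i, j) * \<sigma> (inv g) $$ (k, l)) = (if i = l then c else 0)"
    if "i < d" "l < d" for i l
    using arg_cong[OF c, of "\<lambda>A. A $$ (i, l)"] that by simp
  \<comment> \<open>The scalar is found from the trace of \<open>?M\<close>. Moving
    \<open>\<sigma> g\<close> behind \<open>\<sigma> (inv g)\<close> cancels the two, and every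
    \<open>g\<close> contributes an entry of the identity matrix.\<close>
  have "of_nat d * c = (\<Sum>i = 0..<d. \<Sum>g\<in>carrier G. \<sigma> g $$ (i, j) * \<sigma> (inv g) $$ (k, i))"
    by (simp add: entry)
  also have "\<dots> = (\<Sum>g\<in>carrier G. \<Sum>i = 0..<d. \<sigma> (inv g) $$ (k, i) * \<sigma> g $$ (i, j))"
    by (subst sum.swap) (simp add: mult.commute)
  also have "\<dots> = (\<Sum>g\<in>carrier G. \<sigma> (inv g \<otimes> g) $$ (k, j))"
    using ij kl by (intro sum.cong refl rep_mult_index[OF r, symmetric]) auto
  also have "\<dots> = (\<Sum>g\<in>carrier G. if j = k then 1 else 0)"
    using rep_one[OF r] ij kl by (intro sum.cong refl) auto
  finally have "c = (if j = k then of_nat (card (carrier G)) / of_nat d else 0)"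
    using irreps_dim_pos[OF \<sigma>] by (auto simp: field_simps)
  then show ?thesis using entry[OF ij(1) kl(2)] by auto
qed

section \<open>Representatives of the isomorphism classes\<close>

definition class_rep :: "'a matrep set \<Rightarrow> 'a \<Rightarrow> complex mat" where
  "class_rep C = snd (SOME r. r \<in> C)"

lemma class_rep_in:
  assumes "C \<in> dual G"
  shows "(rep_dim C, class_rep C) \<in> C"
proof -
  have "C \<noteq> {}"
    using assms equiv_rep_iso[of G] unfolding dual_def by (metis in_quotient_imp_non_empty)
  then have r: "(SOME r. r \<in> C) \<in> C" by (simp add: some_in_eq)
  obtain d \<sigma> where d: "(SOME r. r \<in> C) = (d, \<sigma>)" by fastforce
  with rep_dim_eq[OF assms] r show ?thesis by (simp add: class_rep_def)
qed

lemma class_rep_irreps: "C \<in> dual G \<Longrightarrow> (rep_dim C, class_rep C) \<in> irreps G"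
  using class_rep_in equiv_rep_iso[of G] unfolding dual_def by (metis in_quotient_imp_subset subsetD)

lemma class_rep_not_iso:
  assumes "C \<in> dual G" "D \<in> dual G" "C \<noteq> D"
  shows "((rep_dim C, class_rep C), (rep_dim D, class_rep D)) \<notin> rep_iso G"
  using quotient_eq_iff[OF equiv_rep_iso assms(1,2)[unfolded dual_def] class_rep_in class_rep_in] assms
  by simp

lemma irreps_class_rep:
  assumes "(d, \<sigma>) \<in> irreps G"
  obtains C where "C \<in> dual G" "((d, \<sigma>), (rep_dim C, class_rep C)) \<in> rep_iso G" "rep_dim C = d"
proof -
  let ?C = "rep_iso G `` {(d, \<sigma>)}"
  have C: "?C \<in> dual G" using assms by (simp add: dual_def quotientI)
  have "((d, \<sigma>), (rep_dim ?C, class_rep ?C)) \<in> rep_iso G" using class_rep_in[OF C] by simp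
  moreover from this have "rep_dim ?C = d" by (auto elim: rep_isoE)
  ultimately show ?thesis using that C by blast
qed

lemma class_rep: "C \<in> dual G \<Longrightarrow> rep (rep_dim C) (class_rep C)"
  and rep_dim_pos: "C \<in> dual G \<Longrightarrow> 0 < rep_dim C"
  using class_rep_irreps irreps_rep irreps_dim_pos by blast+

lemma card_carrier_pos: "0 < card (carrier G)"
  using finite_carrier by (auto simp: card_gt_0_iff)

section \<open>Convolution and Fourier coefficients\<close>

definition conv :: "('a \<Rightarrow> complex) \<Rightarrow> ('a \<Rightarrow> complex) \<Rightarrow> 'a \<Rightarrow> complex" where
  "conv u v g = (\<Sum>z\<in>carrier G. u z * v (inv z \<otimes> g))"

text \<open>
  \<open>coef C A g\<close> is \<open>d / |G|\<close> times the trace of \<open>\<sigma> g * A\<close>. The factor is the one that turns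
  convolution into matrix multiplication, in reversed order.
\<close>

definition coef :: "'a matrep set \<Rightarrow> (nat \<Rightarrow> nat \<Rightarrow> complex) \<Rightarrow> 'a \<Rightarrow> complex" where
  "coef C A g = of_nat (rep_dim C) / of_nat (card (carrier G)) *
     (\<Sum>i = 0..<rep_dim C. \<Sum>j = 0..<rep_dim C. class_rep C g $$ (i, j) * A j i)"

text \<open>The set \<open>S\<close> is a parameter because the sum over the support alone yields
  \<open>\<Pi>\<close>, and because the formulas are needed for finite \<open>S\<close> before the
  dual is known to be finite.\<close>

definition fourier_inv ::
    "'a matrep set set \<Rightarrow> ('a matrep set \<Rightarrow> nat \<Rightarrow> nat \<Rightarrow> complex) \<Rightarrow> 'a \<Rightarrow> complex" where
  "fourier_inv S A g = (\<Sum>C\<in>S. coef C (A C) g)"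

text \<open>Fourier coefficients are plain functions of two indices, which avoids carrier
  conditions; by \<open>coef_cong\<close> only indices below the dimension matter.\<close>

definition id_mat :: "nat \<Rightarrow> nat \<Rightarrow> complex" where
  "id_mat i j = (if i = j then 1 else 0)"

definition mult_upto :: "nat \<Rightarrow> (nat \<Rightarrow> nat \<Rightarrow> complex) \<Rightarrow> (nat \<Rightarrow> nat \<Rightarrow> complex) \<Rightarrow> nat \<Rightarrow> nat \<Rightarrow> complex" where
  "mult_upto d A B i j = (\<Sum>m = 0..<d. A i m * B m j)"

lemma mult_upto_id: "i < d \<Longrightarrow> j < d \<Longrightarrow> mult_upto d id_mat A i j = A i j"
  "i < d \<Longrightarrow> j < d \<Longrightarrow> mult_upto d A id_mat i j = A i j"
  by (simp_all add: mult_upto_def id_mat_def if_distrib[of "\<lambda>x. x * _"] if_distrib[of "(*) _"] cong: if_cong)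

lemma coef_cong:
  "(\<And>i j. i < rep_dim C \<Longrightarrow> j < rep_dim C \<Longrightarrow> A i j = B i j) \<Longrightarrow> coef C A g = coef C B g"
  unfolding coef_def by (intro arg_cong[of _ _ "(*) _"] sum.cong) auto

lemma coef_sum: "coef C (\<lambda>i j. \<Sum>k\<in>I. A k i j) g = (\<Sum>k\<in>I. coef C (A k) g)"
  unfolding coef_def sum_distrib_left
  by (subst (2) sum.swap, subst (3) sum.swap) simp

lemma coef_scale: "coef C (\<lambda>i j. c * A i j) g = c * coef C A g"
  unfolding coef_def sum_distrib_left by (intro sum.cong refl) (simp add: mult_ac)

lemma coef_one:
  assumes "C \<in> dual G"
  shows "coef C A \<one> = of_nat (rep_dim C) / of_nat (card (carrier G)) * (\<Sum>i = 0..<rep_dim C. A i i)"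
  using rep_one[OF class_rep[OF assms]] unfolding coef_def
  by (simp add: if_distrib[of "\<lambda>x. x * _"] cong: if_cong)

text \<open>The Fourier transform undoes \<open>coef\<close>: the factor in \<open>coef\<close> is
  the reciprocal of the constant in \<open>schur_orthogonality_same\<close>, and distinct classes
  are orthogonal.\<close>

lemma sum_coef_class_rep:
  assumes C: "C \<in> dual G" and D: "D \<in> dual G" and kl: "k < rep_dim D" "l < rep_dim D"
  shows "(\<Sum>g\<in>carrier G. coef C A g * class_rep D (inv g) $$ (k, l)) = (if C = D then A k l else 0)"
proof -
  let ?d = "rep_dim C" and ?c = "of_nat (rep_dim C) / of_nat (card (carrier G)) :: complex"
  let ?s = "\<lambda>i j. \<Sum>g\<in>carrier G. class_rep C g $$ (i, j) * class_rep D (inv g) $$ (k, l)"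
  have "(\<Sum>g\<in>carrier G. coef C A g * class_rep D (inv g) $$ (k, l))
      = (\<Sum>g\<in>carrier G. \<Sum>i = 0..<?d. \<Sum>j = 0..<?d. ?c * A j i * (class_rep C g $$ (i, j) * class_rep D (inv g) $$ (k, l)))"
    unfolding coef_def sum_distrib_left sum_distrib_right by (intro sum.cong refl) (simp add: mult_ac)
  also have "\<dots> = (\<Sum>i = 0..<?d. \<Sum>j = 0..<?d. ?c * A j i * ?s i j)"
    by (subst sum.swap, intro sum.cong refl, subst sum.swap) (simp add: sum_distrib_left)
  also have "\<dots> = (if C = D then A k l else 0)"
  proof (cases "C = D")
    case True
    have "(\<Sum>i = 0..<?d. \<Sum>j = 0..<?d. ?c * A j i * ?s i j)
        = (\<Sum>i = 0..<?d. \<Sum>j = 0..<?d. if j = k then if i = l then A j i else 0 else 0)"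
      using kl True rep_dim_pos[OF C] card_carrier_pos
      by (intro sum.cong refl) (simp add: schur_orthogonality_same[OF class_rep_irreps[OF D]])
    then show ?thesis using kl True by simp
  next
    case False
    then have "?s i j = 0" if "i < ?d" "j < ?d" for i j
      using schur_orthogonality_distinct[OF class_rep_irreps[OF C] class_rep_irreps[OF D]
          class_rep_not_iso[OF D C] that kl] by simp
    then show ?thesis using False by simp
  qed
  finally show ?thesis .
qed

text \<open>In the trace of \<open>\<tau> (inv z \<otimes> g) * B\<close>, cyclicity brings
  \<open>\<tau> (inv z)\<close> to the right of \<open>B\<close>. Summed against
  \<open>coef C A z\<close> it becomes \<open>A\<close>, or zero for different classes. This is
  where the order is reversed.\<close>

lemma conv_coef:
  assumes C: "C \<in> dual G" and D: "D \<in> dual G" and g: "g \<in> carrier G"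
  shows "conv (coef C A) (coef D B) g = (if C = D then coef C (mult_upto (rep_dim C) B A) g else 0)"
proof -
  let ?d = "rep_dim D" and ?c = "of_nat (rep_dim D) / of_nat (card (carrier G)) :: complex"
  let ?\<tau> = "class_rep D"
  have "coef D B (inv z \<otimes> g) =
      (\<Sum>m = 0..<?d. \<Sum>j = 0..<?d. \<Sum>i = 0..<?d. ?c * ?\<tau> g $$ (m, j) * B j i * ?\<tau> (inv z) $$ (i, m))"
    if z: "z \<in> carrier G" for z
  proof -
    have "coef D B (inv z \<otimes> g) =
      (\<Sum>i = 0..<?d. \<Sum>j = 0..<?d. \<Sum>m = 0..<?d. ?c * ?\<tau> g $$ (m, j) * B j i * ?\<tau> (inv z) $$ (i, m))"
      unfolding coef_def sum_distrib_left using z g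
      by (intro sum.cong refl) (simp add: rep_mult_index[OF class_rep[OF D]] sum_distrib_left sum_distrib_right mult_ac)
    also have "\<dots> = (\<Sum>i = 0..<?d. \<Sum>m = 0..<?d. \<Sum>j = 0..<?d. ?c * ?\<tau> g $$ (m, j) * B j i * ?\<tau> (inv z) $$ (i, m))"
      by (intro sum.cong refl sum.swap)
    also have "\<dots> = (\<Sum>m = 0..<?d. \<Sum>i = 0..<?d. \<Sum>j = 0..<?d. ?c * ?\<tau> g $$ (m, j) * B j i * ?\<tau> (inv z) $$ (i, m))"
      by (rule sum.swap)
    also have "\<dots> = (\<Sum>m = 0..<?d. \<Sum>j = 0..<?d. \<Sum>i = 0..<?d. ?c * ?\<tau> g $$ (m, j) * B j i * ?\<tau> (inv z) $$ (i, m))"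
      by (intro sum.cong refl sum.swap)
    finally show ?thesis .
  qed
  then have "conv (coef C A) (coef D B) g =
      (\<Sum>z\<in>carrier G. \<Sum>m = 0..<?d. \<Sum>j = 0..<?d. \<Sum>i = 0..<?d.
        ?c * ?\<tau> g $$ (m, j) * B j i * (coef C A z * ?\<tau> (inv z) $$ (i, m)))"
    unfolding conv_def by (simp add: sum_distrib_left mult_ac)
  also have "\<dots> = (\<Sum>m = 0..<?d. \<Sum>j = 0..<?d. \<Sum>i = 0..<?d.
        ?c * ?\<tau> g $$ (m, j) * B j i * (\<Sum>z\<in>carrier G. coef C A z * ?\<tau> (inv z) $$ (i, m)))"
    unfolding sum_distrib_left
    by (subst sum.swap, intro sum.cong refl, subst sum.swap, intro sum.cong refl, subst sum.swap) simp
  also have "\<dots> = (\<Sum>m = 0..<?d. \<Sum>j = 0..<?d. \<Sum>i = 0..<?d.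
        ?c * ?\<tau> g $$ (m, j) * B j i * (if C = D then A i m else 0))"
    by (intro sum.cong refl arg_cong[of _ _ "(*) _"] sum_coef_class_rep[OF C D]) auto
  also have "\<dots> = (if C = D then coef C (mult_upto (rep_dim C) B A) g else 0)"
    unfolding coef_def mult_upto_def by (simp add: sum_distrib_left mult_ac)
  finally show ?thesis .
qed

lemma conv_fourier_inv:
  assumes S: "S \<subseteq> dual G" "finite S" and g: "g \<in> carrier G"
  shows "conv (fourier_inv S A) (fourier_inv S B) g =
     fourier_inv S (\<lambda>C. mult_upto (rep_dim C) (B C) (A C)) g"
proof -
  have "conv (fourier_inv S A) (fourier_inv S B) g
      = (\<Sum>C\<in>S. \<Sum>D\<in>S. conv (coef C (A C)) (coef D (B D)) g)"
    unfolding conv_def fourier_inv_def sum_product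
    by (subst sum.swap, intro sum.cong refl, subst sum.swap) simp
  also have "\<dots> = (\<Sum>C\<in>S. \<Sum>D\<in>S. if C = D then coef C (mult_upto (rep_dim C) (B C) (A C)) g else 0)"
    using S g by (intro sum.cong refl) (auto simp: conv_coef subset_iff)
  also have "\<dots> = fourier_inv S (\<lambda>C. mult_upto (rep_dim C) (B C) (A C)) g"
    using S by (simp add: fourier_inv_def)
  finally show ?thesis .
qed

section \<open>Hermitian idempotent functions and finiteness of the dual\<close>

definition hermitian :: "('a \<Rightarrow> complex) \<Rightarrow> bool" where
  "hermitian u \<longleftrightarrow> (\<forall>g\<in>carrier G. u (inv g) = cnj (u g))"

definition idempotent :: "('a \<Rightarrow> complex) \<Rightarrow> bool" where
  "idempotent u \<longleftrightarrow> (\<forall>g\<in>carrier G. conv u u g = u g)"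

text \<open>Evaluated at the identity, the convolution of \<open>u\<close> with itself pairs
  \<open>u z\<close> with \<open>u (inv z)\<close>, which is its conjugate. In operator terms, the
  trace of a projection is its squared Hilbert-Schmidt norm.\<close>

lemma hermitian_idempotent_one:
  assumes "hermitian u" "idempotent u"
  shows "u \<one> = of_real (\<Sum>g\<in>carrier G. (cmod (u g))\<^sup>2)"
proof -
  have "u \<one> = conv u u \<one>" using assms(2) by (simp add: idempotent_def)
  also have "\<dots> = (\<Sum>g\<in>carrier G. u g * cnj (u g))"
    using assms(1) unfolding conv_def hermitian_def by (intro sum.cong) auto
  finally have "u \<one> = (\<Sum>g\<in>carrier G. u g * cnj (u g))" .
  then show ?thesis by (simp only: complex_norm_square of_real_sum)
qed

lemma fourier_inv_idempotent:
  assumes S: "S \<subseteq> dual G" "finite S"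
    and "\<And>C i j. C \<in> S \<Longrightarrow> i < rep_dim C \<Longrightarrow> j < rep_dim C \<Longrightarrow> mult_upto (rep_dim C) (A C) (A C) i j = A C i j"
  shows "idempotent (fourier_inv S A)"
  unfolding idempotent_def
  by (auto simp: conv_fourier_inv[OF S] fourier_inv_def assms intro!: sum.cong coef_cong)

text \<open>The positive definite matrix \<open>\<Sum>g. (\<sigma> g)\<^sup>* \<sigma> g\<close> intertwines \<open>\<sigma>\<close> with its conjugate dual.\<close>

lemma character_inv:
  assumes \<sigma>: "rep d \<sigma>" and x: "x \<in> carrier G"
  shows "(\<Sum>i = 0..<d. \<sigma> (inv x) $$ (i, i)) = cnj (\<Sum>i = 0..<d. \<sigma> x $$ (i, i))"
proof -
  define B where "B = mat d d (\<lambda>(j, l). \<Sum>g\<in>carrier G. \<Sum>i = 0..<d. cnj (\<sigma> g $$ (i, j)) * \<sigma> g $$ (i, l))"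
  define T where "T = mat d d (\<lambda>(j, l). cnj (\<sigma> x $$ (l, j)))"
  have B: "B \<in> carrier_mat d d" and T: "T \<in> carrier_mat d d" by (simp_all add: B_def T_def)
  have sx: "\<sigma> (inv x) \<in> carrier_mat d d" using rep_carrier[OF \<sigma>] x by simp
  have "inj_mat B"
  proof (rule inj_matI[OF B])
    fix v assume v: "v \<in> carrier_vec d" "B *\<^sub>v v = 0\<^sub>v d"
    \<comment> \<open>The quadratic form of \<open>B\<close> at \<open>v\<close> is the sum of the
      squared norms of all \<open>\<sigma> g *\<^sub>v v\<close>; the term of the identity alone
      then forces \<open>v\<close> to vanish.\<close>
    have "(\<Sum>g\<in>carrier G. \<Sum>i = 0..<d. (cmod ((\<sigma> g *\<^sub>v v) $ i))\<^sup>2) = (0::real)"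
    proof -
      have "complex_of_real (\<Sum>g\<in>carrier G. \<Sum>i = 0..<d. (cmod ((\<sigma> g *\<^sub>v v) $ i))\<^sup>2)
          = (\<Sum>g\<in>carrier G. \<Sum>i = 0..<d. cnj ((\<sigma> g *\<^sub>v v) $ i) * (\<sigma> g *\<^sub>v v) $ i)"
        unfolding of_real_sum by (intro sum.cong refl) (simp only: complex_norm_square mult.commute)
      also have "\<dots> = (\<Sum>g\<in>carrier G. \<Sum>i = 0..<d. \<Sum>j = 0..<d. \<Sum>l = 0..<d.
          cnj (v $ j) * (cnj (\<sigma> g $$ (i, j)) * \<sigma> g $$ (i, l) * v $ l))"
        using v(1) rep_carrier[OF \<sigma>]
        by (intro sum.cong refl)
          (simp add: mult_mat_vec_index_sum[of _ d d] sum_product mult_ac del: index_mult_mat_vec, rule sum.swap)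
      also have "\<dots> = (\<Sum>g\<in>carrier G. \<Sum>j = 0..<d. \<Sum>i = 0..<d. \<Sum>l = 0..<d. 
          cnj (v $ j) * (cnj (\<sigma> g $$ (i, j)) * \<sigma> g $$ (i, l) * v $ l))"
        by (intro sum.cong refl sum.swap)
      also have "\<dots> = (\<Sum>j = 0..<d. \<Sum>g\<in>carrier G. \<Sum>i = 0..<d. \<Sum>l = 0..<d. 
          cnj (v $ j) * (cnj (\<sigma> g $$ (i, j)) * \<sigma> g $$ (i, l) * v $ l))"
        by (rule sum.swap)
      also have "\<dots> = (\<Sum>j = 0..<d. \<Sum>g\<in>carrier G. \<Sum>l = 0..<d. \<Sum>i = 0..<d. 
          cnj (v $ j) * (cnj (\<sigma> g $$ (i, j)) * \<sigma> g $$ (i, l) * v $ l))"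
        by (intro sum.cong refl sum.swap)
      also have "\<dots> = (\<Sum>j = 0..<d. \<Sum>l = 0..<d. \<Sum>g\<in>carrier G. \<Sum>i = 0..<d. 
          cnj (v $ j) * (cnj (\<sigma> g $$ (i, j)) * \<sigma> g $$ (i, l) * v $ l))"
        by (intro sum.cong refl sum.swap)
      also have "\<dots> = (\<Sum>j = 0..<d. cnj (v $ j) * (B *\<^sub>v v) $ j)"
        by (intro sum.cong refl, simp add: mult_mat_vec_index_sum[OF B v(1)] del: index_mult_mat_vec)
          (simp add: B_def sum_distrib_left sum_distrib_right mult_ac)
      also have "\<dots> = 0" using v by simp
      finally show ?thesis using of_real_eq_0_iff by blast
    qed
    then have "(\<Sum>i = 0..<d. (cmod ((\<sigma> \<one> *\<^sub>v v) $ i))\<^sup>2) = 0"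
      using finite_carrier by (subst (asm) sum_nonneg_eq_0_iff) (auto intro!: sum_nonneg)
    then have "\<forall>i\<in>{0..<d}. v $ i = 0"
      unfolding rep_one[OF \<sigma>] one_mult_mat_vec[OF v(1)]
      by (subst (asm) sum_nonneg_eq_0_iff) auto
    then show "v = 0\<^sub>v d" using v(1) by (intro eq_vecI) auto
  qed
  then obtain S where S: "S \<in> carrier_mat d d" "S * B = 1\<^sub>m d" "B * S = 1\<^sub>m d"
    using inj_square_inverse[OF B] by metis
  \<comment> \<open>\<open>T\<close> is the conjugate transpose of \<open>\<sigma> x\<close>, and
    the identity says that \<open>\<sigma> x\<close> preserves the form \<open>B\<close>. It comes
    from translating \<open>g\<close> by \<open>inv x\<close>.\<close>
  have "B * \<sigma> (inv x) = T * B"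
  proof (rule eq_matI)
    fix j l assume "j < dim_row (T * B)" "l < dim_col (T * B)"
    then have jl: "j < d" "l < d" using T B by auto
    have "(B * \<sigma> (inv x)) $$ (j, l)
        = (\<Sum>g\<in>carrier G. \<Sum>i = 0..<d. cnj (\<sigma> g $$ (i, j)) * (\<Sum>m = 0..<d. \<sigma> g $$ (i, m) * \<sigma> (inv x) $$ (m, l)))"
      unfolding mult_mat_index_sum[OF B sx jl] using jl
      by (simp add: B_def sum_distrib_left sum_distrib_right mult_ac)
        (rule trans[OF sum.swap], rule sum.cong[OF refl], rule sum.swap)
    also have "\<dots> = (\<Sum>g\<in>carrier G. \<Sum>i = 0..<d. cnj (\<sigma> g $$ (i, j)) * \<sigma> (g \<otimes> inv x) $$ (i, l))"
      using jl x by (intro sum.cong refl) (simp add: rep_mult_index[OF \<sigma>])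
    also have "\<dots> = (\<Sum>g\<in>carrier G. \<Sum>i = 0..<d. cnj (\<sigma> (g \<otimes> inv x \<otimes> x) $$ (i, j)) * \<sigma> (g \<otimes> inv x) $$ (i, l))"
      using x by (intro sum.cong refl) (simp add: m_assoc)
    also have "\<dots> = (\<Sum>g\<in>carrier G. \<Sum>i = 0..<d. cnj (\<sigma> (g \<otimes> x) $$ (i, j)) * \<sigma> g $$ (i, l))"
      by (rule sum_mult_right) (simp add: x)
    also have "\<dots> = (\<Sum>g\<in>carrier G. \<Sum>i = 0..<d. (\<Sum>m = 0..<d. cnj (\<sigma> g $$ (i, m)) * cnj (\<sigma> x $$ (m, j))) * \<sigma> g $$ (i, l))"
      using jl x by (intro sum.cong refl) (simp add: rep_mult_index[OF \<sigma>])
    also have "\<dots> = (T * B) $$ (j, l)"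
      unfolding mult_mat_index_sum[OF T B jl] using jl
      by (simp add: B_def T_def sum_distrib_left sum_distrib_right mult_ac)
        (rule sym, rule trans[OF sum.swap], rule sum.cong[OF refl], rule sum.swap)
    finally show "(B * \<sigma> (inv x)) $$ (j, l) = (T * B) $$ (j, l)" .
  qed (use T B sx in auto)
  \<comment> \<open>Thus \<open>\<sigma> (inv x)\<close> is similar to the conjugate transpose of
    \<open>\<sigma> x\<close>; it remains to compare traces by cyclicity.\<close>
  then have "\<sigma> (inv x) = S * (T * B)"
    using assoc_mult_mat[OF S(1) B sx] left_mult_one_mat[OF sx] S(2) by simp
  then have "(\<Sum>i = 0..<d. \<sigma> (inv x) $$ (i, i)) = (\<Sum>i = 0..<d. \<Sum>k = 0..<d. S $$ (i, k) * (T * B) $$ (k, i))"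
    using T B by (simp add: mult_mat_index_sum[OF S(1) mult_carrier_mat[OF T B]] del: index_mult_mat)
  also have "\<dots> = (\<Sum>k = 0..<d. \<Sum>i = 0..<d. (T * B) $$ (k, i) * S $$ (i, k))"
    by (subst sum.swap) (simp add: mult.commute del: index_mult_mat)
  also have "\<dots> = (\<Sum>k = 0..<d. (T * B * S) $$ (k, k))"
    by (simp add: mult_mat_index_sum[OF mult_carrier_mat[OF T B] S(1)] del: index_mult_mat)
  also have "T * B * S = T" using S T B by simp
  finally show ?thesis by (simp add: T_def)
qed

lemma coef_id_inv: "C \<in> dual G \<Longrightarrow> hermitian (coef C id_mat)"
  unfolding hermitian_def coef_def id_mat_def
  using character_inv[OF class_rep] by (simp add: if_distrib[of "(*) _"] cong: if_cong)

lemma hermitian_sum: "(\<And>C. C \<in> S \<Longrightarrow> hermitian (u C)) \<Longrightarrow> hermitian (\<lambda>g. \<Sum>C\<in>S. u C g)"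
  by (simp add: hermitian_def)

lemma coef_id_class_function:
  assumes C: "C \<in> dual G" and "x \<in> carrier G" "y \<in> carrier G"
  shows "coef C id_mat (x \<otimes> y) = coef C id_mat (y \<otimes> x)"
proof -
  have "(\<Sum>i = 0..<rep_dim C. class_rep C (x \<otimes> y) $$ (i, i)) = (\<Sum>i = 0..<rep_dim C. class_rep C (y \<otimes> x) $$ (i, i))"
    using assms(2,3) by (simp add: rep_mult_index[OF class_rep[OF C]]) (subst sum.swap, simp add: mult.commute)
  then show ?thesis
    unfolding coef_def id_mat_def by (simp add: if_distrib[of "(*) _"] cong: if_cong)
qed

lemma coef_id_one: "C \<in> dual G \<Longrightarrow> coef C id_mat \<one> = of_real ((real (rep_dim C))\<^sup>2 / real (card (carrier G)))"
  by (simp add: coef_one id_mat_def power2_eq_square)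

text \<open>For finite \<open>S\<close> the sum \<open>?u\<close> of the block idempotents is a
  hermitian idempotent. Its value \<open>t\<close> at the identity satisfies
  \<open>t\<^sup>2 \<le> t\<close>, so \<open>t \<le> 1\<close>. Each class adds at least the
  reciprocal of the group order to \<open>t\<close>, hence \<open>S\<close> has at most as many
  elements as the group.\<close>

lemma finite_dual: "finite (dual G)"
proof (rule ccontr)
  assume "infinite (dual G)"
  then obtain S where S: "S \<subseteq> dual G" "finite S" "card S = Suc (card (carrier G))"
    using infinite_arbitrarily_large by metis
  define t where "t = (\<Sum>C\<in>S. (real (rep_dim C))\<^sup>2 / real (card (carrier G)))"
  let ?u = "fourier_inv S (\<lambda>C. id_mat)"
  have u1: "?u \<one> = of_real t"
    unfolding fourier_inv_def t_def of_real_sum using S(1) by (intro sum.cong refl coef_id_one) auto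
  have "hermitian ?u" unfolding fourier_inv_def using S(1) coef_id_inv by (intro hermitian_sum) auto
  moreover have "idempotent ?u" by (rule fourier_inv_idempotent[OF S(1,2)]) (simp add: mult_upto_id)
  ultimately have "of_real t = complex_of_real (\<Sum>g\<in>carrier G. (cmod (?u g))\<^sup>2)"
    using hermitian_idempotent_one u1 by simp
  then have "t = (\<Sum>g\<in>carrier G. (cmod (?u g))\<^sup>2)" using of_real_eq_iff by blast
  also have "\<dots> \<ge> (cmod (?u \<one>))\<^sup>2" using finite_carrier by (intro member_le_sum) auto
  finally have "t\<^sup>2 \<le> t" by (simp add: u1)
  have "t \<le> 1"
  proof (rule ccontr)
    assume "\<not> t \<le> 1"
    then have "t * 1 < t * t" by (intro mult_strict_left_mono) auto
    with \<open>t\<^sup>2 \<le> t\<close> show False by (simp add: power2_eq_square)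
  qed
  moreover have "(\<Sum>C\<in>S. 1 / real (card (carrier G))) \<le> t"
    unfolding t_def using S(1) rep_dim_pos by (intro sum_mono divide_right_mono) (auto simp: Suc_le_eq)
  then have "real (card S) \<le> t * real (card (carrier G))"
    using card_carrier_pos by (simp add: field_simps)
  ultimately have "real (card S) \<le> real (card (carrier G))"
    using mult_right_mono[of t 1 "real (card (carrier G))"] by simp
  then show False using S(3) by simp
qed

text \<open>An invariant subspace of least positive dimension inside the fixed space of \<open>X\<close> is irreducible.\<close>

lemma irreducible_in_fixed_space:
  assumes R: "rep N R" and X: "X \<in> carrier_mat N N"
    and comm: "\<And>g. g \<in> carrier G \<Longrightarrow> X * R g = R g * X"
    and w: "w \<in> carrier_vec N" "w \<noteq> 0\<^sub>v N" "X *\<^sub>v w = w"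
  obtains C T where "C \<in> dual G" "T \<in> carrier_mat N (rep_dim C)" "inj_mat T" "X * T = T"
    "\<And>g. g \<in> carrier G \<Longrightarrow> R g * T = T * class_rep C g"
proof -
  \<comment> \<open>\<open>P k\<close> says that the fixed space of \<open>X\<close> contains an
    invariant subspace of dimension \<open>k\<close>. The columns of \<open>T\<close> are a basis of
    it, and \<open>s\<close> is the matrix of \<open>g\<close> in this basis.\<close>
  define P where "P k \<longleftrightarrow> 0 < k \<and> (\<exists>T\<in>carrier_mat N k. inj_mat T \<and> X * T = T \<and>
      (\<forall>g\<in>carrier G. \<exists>s\<in>carrier_mat k k. R g * T = T * s))" for k
  note Rc = rep_carrier[OF R]
  have "\<exists>k. P k"
  proof -
    let ?W = "{v \<in> carrier_vec N. X *\<^sub>v v = v}"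
    have "VectorSpace.subspace class_ring ?W (module_vec TYPE(complex) N)"
      unfolding subspace_complex_iff using X
      by (auto simp: mult_add_distrib_mat_vec[OF X] mult_mat_vec[OF X])
    then obtain k T where T: "T \<in> carrier_mat N k" "inj_mat T" "(\<lambda>v. T *\<^sub>v v) ` carrier_vec k = ?W"
      by (rule subspace_basis_mat)
    have TW: "T *\<^sub>v v \<in> ?W" if "v \<in> carrier_vec k" for v using T(3) that by blast
    have "k \<noteq> 0"
    proof
      assume "k = 0"
      then have "T *\<^sub>v v = 0\<^sub>v N" if "v \<in> carrier_vec k" for v
        using that T(1) by (intro eq_vecI) (auto simp: scalar_prod_def)
      moreover obtain v where "v \<in> carrier_vec k" "w = T *\<^sub>v v" using w T(3) by auto
      ultimately show False using w(2) by simp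
    qed
    moreover have "X * T = T"
    proof (rule eq_matI)
      fix i j assume "i < dim_row T" "j < dim_col T"
      then have ij: "i < N" "j < k" using T(1) by auto
      have "T *\<^sub>v unit_vec k j = col T j"
        using ij T(1) by (intro eq_vecI) (auto simp: scalar_prod_right_unit)
      then have "X *\<^sub>v col T j = col T j" using TW[of "unit_vec k j"] by simp
      then have "(X *\<^sub>v col T j) $ i = col T j $ i" by simp
      then show "(X * T) $$ (i, j) = T $$ (i, j)" using ij X T(1) by simp
    qed (use X T(1) in auto)
    moreover have "\<exists>s\<in>carrier_mat k k. R g * T = T * s" if g: "g \<in> carrier G" for g
    proof -
      have "R g * T *\<^sub>v v \<in> (\<lambda>v. T *\<^sub>v v) ` carrier_vec k" if v: "v \<in> carrier_vec k" for v
      proof -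
        have Tv: "T *\<^sub>v v \<in> carrier_vec N" "X *\<^sub>v (T *\<^sub>v v) = T *\<^sub>v v" using TW[OF v] by auto
        have "X *\<^sub>v (R g *\<^sub>v (T *\<^sub>v v)) = (X * R g) *\<^sub>v (T *\<^sub>v v)"
          using X Rc[OF g] Tv(1) by simp
        also have "\<dots> = R g *\<^sub>v (X *\<^sub>v (T *\<^sub>v v))"
          unfolding comm[OF g] using X Rc[OF g] Tv(1) by simp
        finally have "R g *\<^sub>v (T *\<^sub>v v) \<in> ?W" using Tv Rc[OF g] by auto
        then show ?thesis using T v Rc[OF g] by simp
      qed
      then show ?thesis
        using mat_factor_through_range[OF T(1) mult_carrier_mat[OF Rc[OF g] T(1)]] by metis
    qed
    ultimately show ?thesis unfolding P_def using T(1,2) by auto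
  qed
  then obtain k where k: "P k" "\<And>l. P l \<Longrightarrow> k \<le> l" by (metis LeastI_ex Least_le)
  then obtain T where T: "T \<in> carrier_mat N k" "inj_mat T" "X * T = T" and k0: "0 < k"
    and "\<forall>g\<in>carrier G. \<exists>s\<in>carrier_mat k k. R g * T = T * s" unfolding P_def by blast
  then obtain s where s: "\<And>g. g \<in> carrier G \<Longrightarrow> s g \<in> carrier_mat k k"
      "\<And>g. g \<in> carrier G \<Longrightarrow> R g * T = T * s g" by metis
  have "rep k s"
    unfolding rep_def
  proof (intro conjI ballI)
    show "s x \<in> carrier_mat k k" if "x \<in> carrier G" for x using s(1) that .
    show "s (x \<otimes> y) = s x * s y" if x: "x \<in> carrier G" and y: "y \<in> carrier G" for x y
    proof (rule inj_mat_cancel[OF T(1,2)])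
      have "T * s (x \<otimes> y) = R x * R y * T" using x y by (simp add: s(2)[symmetric] rep_mult[OF R])
      also have "\<dots> = R x * (T * s y)"
        using assoc_mult_mat[OF Rc[OF x] Rc[OF y] T(1)] s(2)[OF y] by simp
      also have "\<dots> = T * s x * s y"
        using assoc_mult_mat[OF Rc[OF x] T(1) s(1)[OF y]] s(2)[OF x] by simp
      also have "\<dots> = T * (s x * s y)"
        by (rule assoc_mult_mat[OF T(1) s(1)[OF x] s(1)[OF y]])
      finally show "T * s (x \<otimes> y) = T * (s x * s y)" .
    qed (use mult_carrier_mat[OF s(1)[OF x] s(1)[OF y]] s(1) x y in auto)
    show "s \<one> = 1\<^sub>m k"
    proof (rule inj_mat_cancel[OF T(1,2) s(1)])
      show "T * s \<one> = T * 1\<^sub>m k"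
        using s(2)[of \<one>] T(1) rep_one[OF R] by simp
    qed auto
  qed
  \<comment> \<open>An invariant \<open>W\<close> with basis matrix \<open>U\<close> lifts to the
    invariant range of \<open>T * U\<close>. This is a competitor in \<open>P\<close>, so minimality
    of \<open>k\<close> allows only the dimensions \<open>0\<close> and \<open>k\<close>.\<close>
  moreover have "W = {0\<^sub>v k} \<or> W = carrier_vec k" if "invariant_subspace G k s W" for W
  proof -
    have W: "VectorSpace.subspace class_ring W (module_vec TYPE(complex) k)"
      and inv: "\<And>x w. x \<in> carrier G \<Longrightarrow> w \<in> W \<Longrightarrow> s x *\<^sub>v w \<in> W"
      using that by (auto simp: invariant_subspace_def)
    obtain l U where U: "U \<in> carrier_mat k l" "inj_mat U" "(\<lambda>v. U *\<^sub>v v) ` carrier_vec l = W"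
      using subspace_basis_mat[OF W] .
    have lk: "l \<le> k" by (rule inj_mat_cols_le_rows[OF U(1,2)])
    have TU: "T * U \<in> carrier_mat N l" using T(1) U(1) by simp
    have XTU: "X * (T * U) = T * U"
      using assoc_mult_mat[OF X T(1) U(1)] T(3) by simp
    have RTU: "\<exists>r\<in>carrier_mat l l. R g * (T * U) = T * U * r" if g: "g \<in> carrier G" for g
    proof -
      have "s g * U *\<^sub>v v \<in> (\<lambda>v. U *\<^sub>v v) ` carrier_vec l" if v: "v \<in> carrier_vec l" for v
      proof -
        have "U *\<^sub>v v \<in> W" using U(3) v by blast
        then have "s g *\<^sub>v (U *\<^sub>v v) \<in> W" by (rule inv[OF g])
        then show ?thesis using U s(1)[OF g] v by simp
      qed
      then obtain r where r: "r \<in> carrier_mat l l" "s g * U = U * r"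
        using mat_factor_through_range[OF U(1) mult_carrier_mat[OF s(1)[OF g] U(1)]] by metis
      have "R g * (T * U) = T * (s g * U)"
        using assoc_mult_mat[OF Rc[OF g] T(1) U(1)] assoc_mult_mat[OF T(1) s(1)[OF g] U(1)] s(2)[OF g]
        by simp
      also have "\<dots> = T * U * r" using assoc_mult_mat[OF T(1) U(1) r(1)] r(2) by simp
      finally show ?thesis using r(1) by blast
    qed
    show ?thesis
    proof (cases "l = 0")
      case True
      then have "U *\<^sub>v v = 0\<^sub>v k" if "v \<in> carrier_vec l" for v
        using that U(1) by (intro eq_vecI) (auto simp: scalar_prod_def)
      then have "W \<subseteq> {0\<^sub>v k}" using U(3) by auto
      moreover have "0\<^sub>v k \<in> W" using W by (simp add: subspace_complex_iff)
      ultimately show ?thesis by blast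
    next
      case False
      then have "P l" unfolding P_def using TU inj_mat_mult[OF T(1,2) U(1,2)] XTU RTU by blast
      then have "l = k" using k(2) lk by fastforce
      then obtain V where V: "V \<in> carrier_mat k k" "U * V = 1\<^sub>m k"
        using inj_square_inverse[of U k] U(1,2) by metis
      have "v \<in> W" if v: "v \<in> carrier_vec k" for v
      proof -
        have "U *\<^sub>v (V *\<^sub>v v) = v"
          using assoc_mult_mat_vec[OF U(1), of V k v] V v \<open>l = k\<close> by simp
        moreover have "V *\<^sub>v v \<in> carrier_vec l" using V v \<open>l = k\<close> by simp
        ultimately show ?thesis using U(3) by (metis imageI)
      qed
      then show ?thesis using W by (auto simp: subspace_complex_iff)
    qed
  qed
  ultimately have "(k, s) \<in> irreps G" by (simp add: irreps_def rep_hom_GL k0)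
  \<comment> \<open>Replacing \<open>T\<close> by \<open>T * V\<close>, with \<open>V\<close> the
    inverse of the isomorphism \<open>S\<close>, changes the basis so that the restriction is
    literally the chosen representative of its class.\<close>
  then obtain C where C: "C \<in> dual G" "((k, s), (rep_dim C, class_rep C)) \<in> rep_iso G" "rep_dim C = k"
    by (rule irreps_class_rep)
  then obtain S where S: "S \<in> carrier (GL k)" "\<And>x. x \<in> carrier G \<Longrightarrow> S * s x = class_rep C x * S"
    unfolding rep_iso_def by auto
  then obtain V where V: "V \<in> carrier_mat k k" "V * S = 1\<^sub>m k" "S * V = 1\<^sub>m k"
    and Sc: "S \<in> carrier_mat k k" unfolding GL_carrier_iff by blast
  have "inj_mat V"
  proof (rule inj_matI[OF V(1)])
    fix v assume v: "v \<in> carrier_vec k" "V *\<^sub>v v = 0\<^sub>v k"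
    have "v = S *\<^sub>v (V *\<^sub>v v)" using assoc_mult_mat_vec[OF Sc V(1) v(1)] V(3) v(1) by simp
    also have "\<dots> = 0\<^sub>v k" using v(2) Sc by auto
    finally show "v = 0\<^sub>v k" .
  qed
  show ?thesis
  proof (rule that[OF C(1), of "T * V"])
    show "T * V \<in> carrier_mat N (rep_dim C)" using T(1) V(1) C(3) by simp
    show "inj_mat (T * V)" by (rule inj_mat_mult[OF T(1,2) V(1)]) fact
    show "X * (T * V) = T * V" using assoc_mult_mat[OF X T(1) V(1)] T(3) by simp
    fix g assume g: "g \<in> carrier G"
    have c: "class_rep C g \<in> carrier_mat k k" using rep_carrier[OF class_rep[OF C(1)] g] C(3) by simp
    have "V * class_rep C g = V * (class_rep C g * (S * V))" using V(3) c by simp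
    also have "\<dots> = V * (S * s g * V)"
      using assoc_mult_mat[OF c Sc V(1)] S(2)[OF g] by simp
    also have "\<dots> = V * (S * (s g * V))" using assoc_mult_mat[OF Sc s(1)[OF g] V(1)] by simp
    also have "\<dots> = s g * V"
      using assoc_mult_mat[OF V(1) Sc mult_carrier_mat[OF s(1)[OF g] V(1)]] V(2)
        left_mult_one_mat[OF mult_carrier_mat[OF s(1)[OF g] V(1)]] by simp
    finally have Vc: "V * class_rep C g = s g * V" .
    have "R g * (T * V) = T * s g * V"
      using assoc_mult_mat[OF Rc[OF g] T(1) V(1)] s(2)[OF g] by simp
    also have "\<dots> = T * (V * class_rep C g)"
      using assoc_mult_mat[OF T(1) s(1)[OF g] V(1)] Vc by simp
    also have "\<dots> = T * V * class_rep C g"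
      by (rule assoc_mult_mat[OF T(1) V(1) c, symmetric])
    finally show "R g * (T * V) = T * V * class_rep C g" .
  qed
qed

text \<open>Convolution by a class function commutes with the right regular representation, and
  idempotence makes \<open>f\<close> a fixed vector of it. If \<open>f\<close> is nonzero, the fixed
  space contains an irreducible subrepresentation. There convolution by \<open>f\<close> is also
  given by the transform of \<open>f\<close>, which vanishes.\<close>

lemma conv_class_function_idempotent_zero:
  assumes cls: "\<And>x y. x \<in> carrier G \<Longrightarrow> y \<in> carrier G \<Longrightarrow> f (x \<otimes> y) = f (y \<otimes> x)"
    and idem: "idempotent f"
    and zero: "\<And>C k l. C \<in> dual G \<Longrightarrow> k < rep_dim C \<Longrightarrow> l < rep_dim C \<Longrightarrow>
      (\<Sum>g\<in>carrier G. f g * class_rep C (inv g) $$ (k, l)) = 0"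
    and x: "x \<in> carrier G"
  shows "f x = 0"
proof (rule ccontr)
  assume fx: "f x \<noteq> 0"
  let ?N = "card (carrier G)"
  obtain e where e: "bij_betw e {0..<?N} (carrier G)"
    using ex_bij_betw_nat_finite[OF finite_carrier] by blast
  have eG: "e a \<in> carrier G" if "a < ?N" for a using e that by (auto simp: bij_betw_def)
  have e_inj: "e a = e b \<longleftrightarrow> a = b" if "a < ?N" "b < ?N" for a b
    using e that by (auto simp: bij_betw_def inj_on_def)
  have e_sum: "(\<Sum>a = 0..<?N. h (e a)) = (\<Sum>g\<in>carrier G. h g)" for h :: "'a \<Rightarrow> complex"
    by (rule sum.reindex_bij_betw[OF e])
  have e_surj: "\<exists>a<?N. e a = y" if "y \<in> carrier G" for y
    using e that unfolding bij_betw_def by force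
  \<comment> \<open>In the enumeration \<open>e\<close>, \<open>R\<close> is the right regular
    representation, sending \<open>v\<close> to the function with value
    \<open>v (y \<otimes> g)\<close> at \<open>y\<close>, while \<open>X\<close> sends
    \<open>v\<close> to \<open>conv v f\<close>.\<close>
  define R where "R g = mat ?N ?N (\<lambda>(a, b). if e b = e a \<otimes> g then 1 else 0 :: complex)" for g
  define X where "X = mat ?N ?N (\<lambda>(a, b). f (inv (e b) \<otimes> e a))"
  have Rc: "R g \<in> carrier_mat ?N ?N" for g by (simp add: R_def)
  have X: "X \<in> carrier_mat ?N ?N" by (simp add: X_def)
  have delta: "(\<Sum>b = 0..<?N. (if e b = y then 1 else 0) * h (e b)) = h y"
    if "y \<in> carrier G" for y and h :: "'a \<Rightarrow> complex"
    using that finite_carrier e_sum[of "\<lambda>z. (if z = y then 1 else 0) * h z"]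
    by (simp add: if_distrib[of "\<lambda>x. x * _"] cong: if_cong)
  have R_mult: "(R g * M) $$ (a, j) = h (e a \<otimes> g)"
    if "M \<in> carrier_mat ?N m" "a < ?N" "j < m" "g \<in> carrier G"
      "\<And>b. b < ?N \<Longrightarrow> M $$ (b, j) = h (e b)" for M m a j g h
  proof -
    have "(R g * M) $$ (a, j) = (\<Sum>b = 0..<?N. (if e b = e a \<otimes> g then 1 else 0) * h (e b))"
      unfolding mult_mat_index_sum[OF Rc that(1,2,3)] using that by (simp add: R_def)
    then show ?thesis using delta that eG by simp
  qed
  have rep: "rep ?N R"
    unfolding rep_def
  proof (intro conjI ballI)
    fix g h assume g: "g \<in> carrier G" and h: "h \<in> carrier G"
    show "R (g \<otimes> h) = R g * R h"
    proof (rule eq_matI)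
      fix a c assume "a < dim_row (R g * R h)" "c < dim_col (R g * R h)"
      then have ac: "a < ?N" "c < ?N" by (auto simp: R_def)
      have "(R g * R h) $$ (a, c) = (if e c = e a \<otimes> g \<otimes> h then 1 else 0)"
        by (rule R_mult[OF Rc ac g]) (use ac in \<open>simp add: R_def\<close>)
      then show "R (g \<otimes> h) $$ (a, c) = (R g * R h) $$ (a, c)"
        using ac g h eG by (simp add: R_def m_assoc)
    qed (simp_all add: R_def)
  next
    show "R \<one> = 1\<^sub>m ?N" using eG e_inj by (intro eq_matI) (auto simp: R_def)
  qed (rule Rc)
  have comm: "X * R g = R g * X" if g: "g \<in> carrier G" for g
  proof (rule eq_matI)
    fix a c assume "a < dim_row (R g * X)" "c < dim_col (R g * X)"
    then have ac: "a < ?N" "c < ?N" by (auto simp: R_def X_def)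
    have "(X * R g) $$ (a, c) = (\<Sum>b = 0..<?N. (if e b = e c \<otimes> inv g then 1 else 0) * f (inv (e b) \<otimes> e a))"
      unfolding mult_mat_index_sum[OF X Rc ac] using ac g eG
      by (intro sum.cong refl) (auto simp: R_def X_def m_assoc inv_solve_right)
    also have "\<dots> = f (inv (e c \<otimes> inv g) \<otimes> e a)" using ac g eG by (intro delta) auto
    also have "\<dots> = f (g \<otimes> (inv (e c) \<otimes> e a))" using ac g eG by (simp add: inv_mult_group m_assoc)
    also have "\<dots> = f (inv (e c) \<otimes> (e a \<otimes> g))" using cls[of g "inv (e c) \<otimes> e a"] ac g eG by (simp add: m_assoc)
    also have "\<dots> = (R g * X) $$ (a, c)"
      by (rule R_mult[OF X ac g, symmetric]) (use ac in \<open>simp add: X_def\<close>)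
    finally show "(X * R g) $$ (a, c) = (R g * X) $$ (a, c)" .
  qed (simp_all add: R_def X_def)
  define w where "w = vec ?N (\<lambda>a. f (e a))"
  have w: "w \<in> carrier_vec ?N" by (simp add: w_def)
  have "X *\<^sub>v w = w"
  proof (rule eq_vecI)
    fix a assume "a < dim_vec w"
    then have a: "a < ?N" by (simp add: w_def)
    have "(X *\<^sub>v w) $ a = (\<Sum>b = 0..<?N. f (e b) * f (inv (e b) \<otimes> e a))"
      unfolding mult_mat_vec_index_sum[OF X w a] using a by (simp add: X_def w_def mult.commute)
    also have "\<dots> = conv f f (e a)" unfolding conv_def by (rule e_sum)
    also have "\<dots> = w $ a" using idem eG[OF a] a by (simp add: idempotent_def w_def)
    finally show "(X *\<^sub>v w) $ a = w $ a" .
  qed (simp add: X_def w_def)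
  moreover have "w \<noteq> 0\<^sub>v ?N"
  proof
    assume w0: "w = 0\<^sub>v ?N"
    obtain a where a: "a < ?N" "e a = x" using e_surj[OF x] by blast
    have "w $ a = 0" using w0 a(1) by simp
    then show False using a fx by (simp add: w_def)
  qed
  ultimately obtain C T where C: "C \<in> dual G" and T: "T \<in> carrier_mat ?N (rep_dim C)" "inj_mat T" "X * T = T"
    and RT: "\<And>g. g \<in> carrier G \<Longrightarrow> R g * T = T * class_rep C g"
    using irreducible_in_fixed_space[OF rep X comm w] by metis
  have Cpos: "0 < rep_dim C" by (rule rep_dim_pos[OF C])
  have T0: "T $$ (a, j) = 0" if aj: "a < ?N" "j < rep_dim C" for a j
  proof -
    define t where "t y = T $$ (inv_into {0..<?N} e y, j)" for y
    have t: "t (e b) = T $$ (b, j)" if "b < ?N" for b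
      using e that by (simp add: t_def bij_betw_def)
    have "T $$ (a, j) = (X * T) $$ (a, j)" using T(3) by simp
    also have "\<dots> = (\<Sum>b = 0..<?N. f (inv (e b) \<otimes> e a) * t (e b))"
      unfolding mult_mat_index_sum[OF X T(1) aj] using aj(1) by (simp add: X_def t)
    also have "\<dots> = (\<Sum>y\<in>carrier G. f (inv y \<otimes> e a) * t y)" by (rule e_sum)
    \<comment> \<open>Inversion and translation together substitute
      \<open>inv y \<otimes> e a\<close> by \<open>g\<close>. This exposes the argument
      \<open>e a \<otimes> inv g\<close> of \<open>t\<close>, on which the intertwining relation
      acts.\<close>
    also have "\<dots> = (\<Sum>g\<in>carrier G. f (inv (inv g) \<otimes> e a) * t (inv g))" by (rule sum_inv[symmetric])
    also have "\<dots> = (\<Sum>g\<in>carrier G. f (inv (inv (g \<otimes> inv (e a))) \<otimes> e a) * t (inv (g \<otimes> inv (e a))))"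
      using eG[OF aj(1)] by (intro sum_mult_right[symmetric]) simp
    also have "\<dots> = (\<Sum>g\<in>carrier G. f g * t (e a \<otimes> inv g))"
      using eG[OF aj(1)] by (intro sum.cong refl) (simp add: inv_mult_group m_assoc)
    also have "\<dots> = (\<Sum>g\<in>carrier G. f g * (T * class_rep C (inv g)) $$ (a, j))"
      using R_mult[OF T(1) aj, of _ t] t by (intro sum.cong refl) (simp add: RT[symmetric])
    also have "\<dots> = (\<Sum>g\<in>carrier G. \<Sum>l = 0..<rep_dim C. T $$ (a, l) * (f g * class_rep C (inv g) $$ (l, j)))"
      using mult_mat_index_sum[OF T(1) rep_carrier[OF class_rep[OF C]] aj]
      by (intro sum.cong refl) (simp add: sum_distrib_left mult_ac)
    also have "\<dots> = (\<Sum>l = 0..<rep_dim C. T $$ (a, l) * (\<Sum>g\<in>carrier G. f g * class_rep C (inv g) $$ (l, j)))"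
      by (subst sum.swap) (simp add: sum_distrib_left)
    also have "\<dots> = 0" using zero[OF C _ aj(2)] by simp
    finally show ?thesis .
  qed
  have "T *\<^sub>v unit_vec (rep_dim C) 0 = 0\<^sub>v ?N"
    using T(1) Cpos T0 by (intro eq_vecI) (auto simp: scalar_prod_right_unit)
  then have "unit_vec (rep_dim C) 0 = (0\<^sub>v (rep_dim C) :: complex vec)"
    by (intro inj_matD[OF T(2,1)]) auto
  then show False using Cpos by (simp add: unit_vec_nonzero)
qed

section \<open>Fourier inversion\<close>

definition delta_one :: "'a \<Rightarrow> complex" where
  "delta_one g = (if g = \<one> then 1 else 0)"

lemma conv_delta_one:
  assumes "g \<in> carrier G"
  shows "conv delta_one u g = u g" "conv u delta_one g = u g"
proof -
  show "conv delta_one u g = u g"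
    using assms finite_carrier unfolding conv_def delta_one_def
    by (simp add: if_distrib[of "\<lambda>x. x * _"] cong: if_cong)
  have "conv u delta_one g = (\<Sum>z\<in>carrier G. if z = g then u z else 0)"
    unfolding conv_def delta_one_def using assms
    by (intro sum.cong refl) (auto, metis inv_equality inv_inv inv_closed)
  then show "conv u delta_one g = u g" using assms finite_carrier by simp
qed

lemma conv_diff_left: "conv (\<lambda>x. u x - v x) w g = conv u w g - conv v w g"
  and conv_diff_right: "conv w (\<lambda>x. u x - v x) g = conv w u g - conv w v g"
  by (simp_all add: conv_def algebra_simps sum_subtractf)

text \<open>The error \<open>f\<close> is the unit of convolution minus an idempotent, hence
  idempotent. Its transform vanishes at every class, since \<open>delta_one\<close> and the sum of
  the block idempotents both transform to the identity matrix.\<close>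

lemma fourier_inv_id:
  assumes "g \<in> carrier G"
  shows "fourier_inv (dual G) (\<lambda>C. id_mat) g = delta_one g"
proof -
  let ?u = "fourier_inv (dual G) (\<lambda>C. id_mat)"
  define f where "f x = delta_one x - ?u x" for x
  have "f g = 0"
  proof (rule conv_class_function_idempotent_zero[OF _ _ _ assms])
    fix x y assume xy: "x \<in> carrier G" "y \<in> carrier G"
    then have "x \<otimes> y = \<one> \<longleftrightarrow> y \<otimes> x = \<one>" by (metis inv_equality l_inv r_inv)
    then show "f (x \<otimes> y) = f (y \<otimes> x)"
      using coef_id_class_function xy by (simp add: f_def fourier_inv_def delta_one_def)
  next
    have u: "conv ?u ?u x = ?u x" if "x \<in> carrier G" for x
      using fourier_inv_idempotent[OF subset_refl finite_dual, of "\<lambda>C. id_mat"] that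
      by (simp add: idempotent_def mult_upto_id)
    show "idempotent f"
      unfolding idempotent_def f_def by (simp add: conv_diff_left conv_diff_right conv_delta_one u)
  next
    fix C k l assume C: "C \<in> dual G" and kl: "k < rep_dim C" "l < rep_dim C"
    have "(\<Sum>x\<in>carrier G. delta_one x * class_rep C (inv x) $$ (k, l)) = id_mat k l"
      using finite_carrier kl rep_one[OF class_rep[OF C]]
      by (simp add: delta_one_def id_mat_def if_distrib[of "\<lambda>x. x * _"] cong: if_cong)
    moreover have "(\<Sum>x\<in>carrier G. ?u x * class_rep C (inv x) $$ (k, l)) = id_mat k l"
      unfolding fourier_inv_def sum_distrib_right
      by (subst sum.swap) (simp add: sum_coef_class_rep[OF _ C kl] finite_dual C)
    ultimately show "(\<Sum>x\<in>carrier G. f x * class_rep C (inv x) $$ (k, l)) = 0"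
      by (simp add: f_def left_diff_distrib sum_subtractf)
  qed
  then show ?thesis by (simp add: f_def)
qed

section \<open>Averages over conjugate subgroups\<close>

lemma conj_subgroup_image:
  "K \<subseteq> carrier G \<Longrightarrow> x \<in> carrier G \<Longrightarrow> conj_subgroup G K x = (\<lambda>h. inv x \<otimes> h \<otimes> x) ` K"
  by (auto simp: conj_subgroup_def l_coset_def r_coset_def)

lemma inj_on_conj: "x \<in> carrier G \<Longrightarrow> inj_on (\<lambda>h. inv x \<otimes> h \<otimes> x) (carrier G)"
  by (intro inj_onI) auto

lemma card_conj_subgroup:
  "K \<subseteq> carrier G \<Longrightarrow> x \<in> carrier G \<Longrightarrow> card (conj_subgroup G K x) = card K"
  unfolding conj_subgroup_image by (rule card_image, rule inj_on_subset[OF inj_on_conj])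

lemma sum_conj_subgroup:
  "K \<subseteq> carrier G \<Longrightarrow> x \<in> carrier G \<Longrightarrow>
    (\<Sum>h\<in>conj_subgroup G K x. f h) = (\<Sum>h\<in>K. f (inv x \<otimes> h \<otimes> x))"
  unfolding conj_subgroup_image by (subst sum.reindex[OF inj_on_subset[OF inj_on_conj]]) auto

lemma subgroup_conj_subgroup:
  assumes K: "subgroup K G" and x: "x \<in> carrier G"
  shows "subgroup (conj_subgroup G K x) G"
proof (rule subgroupI)
  note Kc = subgroup.subset[OF K] and img = conj_subgroup_image[OF subgroup.subset[OF K] x]
  show "conj_subgroup G K x \<subseteq> carrier G" using Kc x unfolding img by auto
  show "conj_subgroup G K x \<noteq> {}" using subgroup.one_closed[OF K] unfolding img by blast
  fix a assume "a \<in> conj_subgroup G K x"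
  then obtain h where h: "h \<in> K" "a = inv x \<otimes> h \<otimes> x" unfolding img by blast
  have "inv a = inv x \<otimes> inv h \<otimes> x"
    using h x Kc by (auto simp: inv_mult_group m_assoc)
  then show "inv a \<in> conj_subgroup G K x"
    unfolding img using subgroup.m_inv_closed[OF K h(1)] by blast
  fix b assume "b \<in> conj_subgroup G K x"
  then obtain k where k: "k \<in> K" "b = inv x \<otimes> k \<otimes> x" unfolding img by blast
  have "x \<otimes> (inv x \<otimes> (k \<otimes> x)) = k \<otimes> x"
    using k x Kc by (subst m_assoc[symmetric]) auto
  then have "a \<otimes> b = inv x \<otimes> (h \<otimes> k) \<otimes> x"
    using h k x Kc by (auto simp: m_assoc subset_iff)
  then show "a \<otimes> b \<in> conj_subgroup G K x"
    unfolding img using subgroup.m_closed[OF K h(1) k(1)] by blast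
qed

lemma conj_subgroup_conj_subgroup:
  assumes "K \<subseteq> carrier G" "x \<in> carrier G" "y \<in> carrier G"
  shows "conj_subgroup G (conj_subgroup G K x) y = conj_subgroup G K (x \<otimes> y)"
proof -
  have "conj_subgroup G K x \<subseteq> carrier G" using assms by (auto simp: conj_subgroup_image)
  then have "conj_subgroup G (conj_subgroup G K x) y = (\<lambda>h. inv y \<otimes> (inv x \<otimes> h \<otimes> x) \<otimes> y) ` K"
    using assms by (simp add: conj_subgroup_image image_image)
  also have "\<dots> = (\<lambda>h. inv (x \<otimes> y) \<otimes> h \<otimes> (x \<otimes> y)) ` K"
  proof (rule image_cong[OF refl])
    fix h assume "h \<in> K"
    then have "h \<in> carrier G" using assms(1) by blast
    then show "inv y \<otimes> (inv x \<otimes> h \<otimes> x) \<otimes> y = inv (x \<otimes> y) \<otimes> h \<otimes> (x \<otimes> y)"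
      using assms(2,3) by (simp add: inv_mult_group m_assoc)
  qed
  also have "\<dots> = conj_subgroup G K (x \<otimes> y)" using assms by (simp add: conj_subgroup_image)
  finally show ?thesis .
qed

lemma conj_subgroup_one: "K \<subseteq> carrier G \<Longrightarrow> conj_subgroup G K \<one> = K"
  by (force simp: conj_subgroup_image subset_iff)

lemma finite_conjugates: "finite (conjugates G H)"
  unfolding conjugates_def using finite_carrier by blast

lemma conjugates_refl: "H \<subseteq> carrier G \<Longrightarrow> H \<in> conjugates G H"
  unfolding conjugates_def using conj_subgroup_one by (metis image_eqI one_closed)

text \<open>Conjugation by \<open>x\<close> permutes the conjugates of \<open>H\<close>, with
  conjugation by \<open>inv x\<close> as its inverse.\<close>

lemma sum_conjugates_conj:
  assumes H: "H \<subseteq> carrier G" and x: "x \<in> carrier G"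
  shows "(\<Sum>K\<in>conjugates G H. f (conj_subgroup G K x)) = (\<Sum>K\<in>conjugates G H. f K)"
proof (rule sum.reindex_bij_witness[of _ "\<lambda>K. conj_subgroup G K (inv x)" "\<lambda>K. conj_subgroup G K x"])
  fix K assume "K \<in> conjugates G H"
  then obtain g where g: "g \<in> carrier G" "K = conj_subgroup G H g" by (auto simp: conjugates_def)
  have c: "conj_subgroup G K y = conj_subgroup G H (g \<otimes> y)" if "y \<in> carrier G" for y
    using conj_subgroup_conj_subgroup[OF H g(1) that] g(2) by simp
  show "conj_subgroup G K x \<in> conjugates G H" "conj_subgroup G K (inv x) \<in> conjugates G H"
    using c g x by (auto simp: conjugates_def)
  show "conj_subgroup G (conj_subgroup G K x) (inv x) = K" "conj_subgroup G (conj_subgroup G K (inv x)) x = K"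
    using c[of x] c[of "inv x"] g x conj_subgroup_conj_subgroup[OF H, of "g \<otimes> x" "inv x"]
      conj_subgroup_conj_subgroup[OF H, of "g \<otimes> inv x" x] by (simp_all add: m_assoc)
qed simp

section \<open>Averages of the irreducible representations and their support\<close>

definition avg_rep :: "'a matrep set \<Rightarrow> 'a set \<Rightarrow> nat \<Rightarrow> nat \<Rightarrow> complex" where
  "avg_rep C K i j = (\<Sum>h\<in>K. class_rep C h $$ (i, j)) / of_nat (card K)"

definition uniform :: "'a set \<Rightarrow> 'a \<Rightarrow> complex" where
  "uniform K g = (if g \<in> K then 1 / of_nat (card K) else 0)"

lemma card_subgroup_pos: "subgroup K G \<Longrightarrow> 0 < card K"
  using finite_carrier subgroup.subset[of K G] subgroup.one_closed[of K G]
  by (metis card_gt_0_iff empty_iff finite_subset)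

lemma sum_subgroup_mult_left:
  assumes K: "subgroup K G" and k: "k \<in> K"
  shows "(\<Sum>h\<in>K. f (k \<otimes> h)) = (\<Sum>h\<in>K. f h)"
  using k subgroup.m_closed[OF K] subgroup.m_inv_closed[OF K] subgroup.mem_carrier[OF K]
  by (intro sum.reindex_bij_witness[of _ "\<lambda>h. inv k \<otimes> h" "\<lambda>h. k \<otimes> h"]) (auto simp: m_assoc[symmetric])

lemma sum_subgroup_inv:
  assumes K: "subgroup K G"
  shows "(\<Sum>h\<in>K. f (inv h)) = (\<Sum>h\<in>K. f h)"
  using subgroup.m_inv_closed[OF K] subgroup.mem_carrier[OF K]
  by (intro sum.reindex_bij_witness[of _ "\<lambda>h. inv h" "\<lambda>h. inv h"]) auto

text \<open>Left multiplication by an element of \<open>N\<close> only permutes \<open>K\<close>.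
  The case \<open>N = K\<close> is idempotence; the normal core as \<open>N\<close> enters the final
  bound.\<close>

lemma avg_rep_absorb:
  assumes C: "C \<in> dual G" and N: "subgroup N G" and K: "subgroup K G" and NK: "N \<subseteq> K"
    and ij: "i < rep_dim C" "j < rep_dim C"
  shows "mult_upto (rep_dim C) (avg_rep C N) (avg_rep C K) i j = avg_rep C K i j"
proof -
  have "mult_upto (rep_dim C) (avg_rep C N) (avg_rep C K) i j
      = (\<Sum>m = 0..<rep_dim C. \<Sum>n\<in>N. \<Sum>k\<in>K. class_rep C n $$ (i, m) * class_rep C k $$ (m, j))
        / (of_nat (card N) * of_nat (card K))"
    unfolding mult_upto_def avg_rep_def by (simp add: sum_product sum_divide_distrib)
  also have "(\<Sum>m = 0..<rep_dim C. \<Sum>n\<in>N. \<Sum>k\<in>K. class_rep C n $$ (i, m) * class_rep C k $$ (m, j))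
      = (\<Sum>n\<in>N. \<Sum>m = 0..<rep_dim C. \<Sum>k\<in>K. class_rep C n $$ (i, m) * class_rep C k $$ (m, j))"
    by (rule sum.swap)
  also have "\<dots> = (\<Sum>n\<in>N. \<Sum>k\<in>K. \<Sum>m = 0..<rep_dim C. class_rep C n $$ (i, m) * class_rep C k $$ (m, j))"
    by (rule sum.cong[OF refl]) (rule sum.swap)
  also have "\<dots> = (\<Sum>n\<in>N. \<Sum>k\<in>K. class_rep C (n \<otimes> k) $$ (i, j))"
    using ij subgroup.mem_carrier[OF N] subgroup.mem_carrier[OF K]
    by (intro sum.cong refl rep_mult_index[OF class_rep[OF C], symmetric]) auto
  also have "\<dots> = (\<Sum>n\<in>N. \<Sum>k\<in>K. class_rep C k $$ (i, j))"
    using NK by (intro sum.cong[OF refl] sum_subgroup_mult_left[OF K]) auto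
  finally show ?thesis
    using card_subgroup_pos[OF N] by (simp add: avg_rep_def[of C K i j])
qed

text \<open>This reduces averages to translates of characters, whose symmetries hold for non-unitary
  representatives as well.\<close>

lemma coef_avg_rep:
  assumes C: "C \<in> dual G" and K: "K \<subseteq> carrier G" and g: "g \<in> carrier G"
  shows "coef C (avg_rep C K) g = (\<Sum>k\<in>K. coef C id_mat (g \<otimes> k)) / of_nat (card K)"
proof -
  have "coef C id_mat (g \<otimes> k) = coef C (\<lambda>i j. class_rep C k $$ (i, j)) g" if "k \<in> K" for k
  proof -
    have k: "k \<in> carrier G" using that K by blast
    show ?thesis unfolding coef_def id_mat_def
      by (rule arg_cong[of _ _ "(*) _"], rule sum.cong[OF refl])
        (simp add: rep_mult_index[OF class_rep[OF C] g k] if_distrib[of "(*) _"] cong: if_cong)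
  qed
  moreover have "coef C (avg_rep C K) g
      = coef C (\<lambda>i j. (1 / of_nat (card K)) * (\<Sum>k\<in>K. class_rep C k $$ (i, j))) g"
    by (rule coef_cong) (simp add: avg_rep_def)
  ultimately show ?thesis by (simp only: coef_scale coef_sum) simp
qed

lemma coef_avg_rep_conj:
  assumes C: "C \<in> dual G" and K: "K \<subseteq> carrier G" and x: "x \<in> carrier G"
  shows "coef C (avg_rep C (conj_subgroup G K x)) \<one> = coef C (avg_rep C K) \<one>"
proof -
  have "coef C id_mat (inv x \<otimes> h \<otimes> x) = coef C id_mat h" if "h \<in> K" for h
    using coef_id_class_function[OF C, of "inv x \<otimes> h" x] that K x
    by (auto simp: m_assoc[symmetric] subset_iff)
  moreover have "conj_subgroup G K x \<subseteq> carrier G" using K x by (auto simp: conj_subgroup_image)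
  ultimately show ?thesis
    using K x by (simp add: coef_avg_rep[OF C] card_conj_subgroup sum_conj_subgroup subset_iff)
qed

text \<open>The function is hermitian even where the averaged matrix is not: characters are
  hermitian class functions, and \<open>K\<close> is closed under inverses.\<close>

lemma coef_avg_rep_hermitian:
  assumes C: "C \<in> dual G" and K: "subgroup K G"
  shows "hermitian (coef C (avg_rep C K))"
  unfolding hermitian_def
proof
  fix g assume g: "g \<in> carrier G"
  note Kc = subgroup.subset[OF K]
  have "(\<Sum>k\<in>K. coef C id_mat (inv g \<otimes> k)) = (\<Sum>k\<in>K. cnj (coef C id_mat (g \<otimes> inv k)))"
  proof (rule sum.cong[OF refl])
    fix k assume "k \<in> K"
    then have k: "k \<in> carrier G" using Kc by blast
    have "coef C id_mat (inv (g \<otimes> inv k)) = cnj (coef C id_mat (g \<otimes> inv k))"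
      using coef_id_inv[OF C] g k unfolding hermitian_def by blast
    moreover have "inv (g \<otimes> inv k) = k \<otimes> inv g" using g k by (simp add: inv_mult_group)
    ultimately show "coef C id_mat (inv g \<otimes> k) = cnj (coef C id_mat (g \<otimes> inv k))"
      using coef_id_class_function[OF C, of k "inv g"] g k by simp
  qed
  also have "\<dots> = (\<Sum>k\<in>K. cnj (coef C id_mat (g \<otimes> k)))"
    by (rule sum_subgroup_inv[OF K])
  finally show "coef C (avg_rep C K) (inv g) = cnj (coef C (avg_rep C K) g)"
    using g by (simp add: coef_avg_rep[OF C Kc])
qed

lemma coef_avg_rep_idempotent:
  assumes C: "C \<in> dual G" and K: "subgroup K G"
  shows "idempotent (coef C (avg_rep C K))"
  using avg_rep_absorb[OF C K K subset_refl] unfolding idempotent_def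
  by (auto simp: conv_coef[OF C C] intro!: coef_cong)

lemma coef_zero: "(\<And>i j. i < rep_dim C \<Longrightarrow> j < rep_dim C \<Longrightarrow> A i j = 0) \<Longrightarrow> coef C A g = 0"
  by (simp add: coef_def)

text \<open>By \<open>hermitian_idempotent_one\<close>, vanishing at the identity forces the whole
  function to vanish, and the Fourier transform then returns a zero average. Membership in the
  support thus depends on a trace only, which is what makes it invariant under conjugation.\<close>

lemma avg_rep_eq_zero_iff:
  assumes C: "C \<in> dual G" and K: "subgroup K G"
  shows "(\<forall>i<rep_dim C. \<forall>j<rep_dim C. avg_rep C K i j = 0) \<longleftrightarrow> coef C (avg_rep C K) \<one> = 0"
proof (intro iffI allI impI)
  fix i j assume z: "coef C (avg_rep C K) \<one> = 0" and ij: "i < rep_dim C" "j < rep_dim C"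
  have "of_real (\<Sum>g\<in>carrier G. (cmod (coef C (avg_rep C K) g))\<^sup>2) = (0::complex)"
    using hermitian_idempotent_one[OF coef_avg_rep_hermitian coef_avg_rep_idempotent] C K z by simp
  then have "(\<Sum>g\<in>carrier G. (cmod (coef C (avg_rep C K) g))\<^sup>2) = 0"
    using of_real_eq_0_iff by blast
  then have "\<forall>g\<in>carrier G. coef C (avg_rep C K) g = 0"
    using finite_carrier by (subst (asm) sum_nonneg_eq_0_iff) auto
  then show "avg_rep C K i j = 0"
    using sum_coef_class_rep[OF C C ij, of "avg_rep C K"] by simp
qed (auto intro: coef_zero)

lemma coef_avg_rep_one_pos:
  assumes C: "C \<in> dual G" and K: "subgroup K G" and nz: "coef C (avg_rep C K) \<one> \<noteq> 0"
  obtains t :: real where "coef C (avg_rep C K) \<one> = of_real t" "0 < t"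
proof -
  note eq = hermitian_idempotent_one[OF coef_avg_rep_hermitian[OF C K] coef_avg_rep_idempotent[OF C K]]
  moreover have "0 \<le> (\<Sum>g\<in>carrier G. (cmod (coef C (avg_rep C K) g))\<^sup>2)" by (intro sum_nonneg) auto
  moreover have "(\<Sum>g\<in>carrier G. (cmod (coef C (avg_rep C K) g))\<^sup>2) \<noteq> 0" using eq nz by (metis of_real_0)
  ultimately show ?thesis using that by (metis less_eq_real_def)
qed

lemma proj_support_iff:
  assumes K: "subgroup K G"
  shows "C \<in> proj_support G K \<longleftrightarrow> C \<in> dual G \<and> coef C (avg_rep C K) \<one> \<noteq> 0"
proof (cases "C \<in> dual G")
  case C: True
  let ?d = "rep_dim C"
  have "(\<exists>(d, \<sigma>)\<in>C. avg_proj K (d, \<sigma>) \<noteq> 0\<^sub>m d d) \<longleftrightarrow> avg_proj K (?d, class_rep C) \<noteq> 0\<^sub>m ?d ?d"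
  proof
    assume "\<exists>(d, \<sigma>)\<in>C. avg_proj K (d, \<sigma>) \<noteq> 0\<^sub>m d d"
    then obtain d \<sigma> where d: "(d, \<sigma>) \<in> C" "avg_proj K (d, \<sigma>) \<noteq> 0\<^sub>m d d" by auto
    have "d = ?d" using rep_dim_eq[OF C d(1)] by simp
    moreover have "((d, \<sigma>), (?d, class_rep C)) \<in> rep_iso G"
      using quotient_eq_iff[OF equiv_rep_iso, of C G C "(d, \<sigma>)" "(?d, class_rep C)"] C d(1) class_rep_in[OF C]
      by (simp add: dual_def)
    ultimately show "avg_proj K (?d, class_rep C) \<noteq> 0\<^sub>m ?d ?d"
      using avg_proj_zero_iso[OF subgroup.subset[OF K]] d(2) by metis
  qed (use class_rep_in[OF C] in auto)
  also have "\<dots> \<longleftrightarrow> \<not> (\<forall>i<?d. \<forall>j<?d. avg_rep C K i j = 0)"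
  proof -
    have "avg_proj K (?d, class_rep C) = 0\<^sub>m ?d ?d \<longleftrightarrow> (\<forall>i<?d. \<forall>j<?d. avg_rep C K i j = 0)"
      by (auto simp: mat_eq_iff avg_proj_def avg_rep_def)
    then show ?thesis by simp
  qed
  finally show ?thesis
    using C unfolding proj_support_def avg_rep_eq_zero_iff[OF C K] by simp
qed (simp add: proj_support_def)

lemma proj_support_conj:
  assumes H: "subgroup H G" and K: "K \<in> conjugates G H"
  shows "proj_support G K = proj_support G H"
proof -
  obtain x where x: "x \<in> carrier G" "K = conj_subgroup G H x" using K by (auto simp: conjugates_def)
  have sK: "subgroup K G" using subgroup_conj_subgroup[OF H x(1)] x(2) by simp
  have "coef C (avg_rep C K) \<one> = coef C (avg_rep C H) \<one>" if "C \<in> dual G" for C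
    using coef_avg_rep_conj[OF that subgroup.subset[OF H] x(1)] x(2) by simp
  then show ?thesis by (auto simp: proj_support_iff[OF H] proj_support_iff[OF sK])
qed

text \<open>Average the inversion formula for \<open>delta_one\<close> over the right translates by
  elements of \<open>K\<close>.\<close>

lemma uniform_fourier_inv:
  assumes K: "subgroup K G" and g: "g \<in> carrier G"
  shows "uniform K g = fourier_inv (dual G) (\<lambda>C. avg_rep C K) g"
proof -
  have "fourier_inv (dual G) (\<lambda>C. avg_rep C K) g
      = (\<Sum>C\<in>dual G. \<Sum>k\<in>K. coef C id_mat (g \<otimes> k)) / of_nat (card K)"
    using g by (simp add: fourier_inv_def coef_avg_rep[OF _ subgroup.subset[OF K]] sum_divide_distrib)
  also have "\<dots> = (\<Sum>k\<in>K. fourier_inv (dual G) (\<lambda>C. id_mat) (g \<otimes> k)) / of_nat (card K)"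
    by (subst sum.swap) (simp add: fourier_inv_def)
  also have "\<dots> = (\<Sum>k\<in>K. delta_one (g \<otimes> k)) / of_nat (card K)"
    using g subgroup.mem_carrier[OF K] by (simp add: fourier_inv_id)
  also have "(\<Sum>k\<in>K. delta_one (g \<otimes> k)) = (\<Sum>k\<in>K. if k = inv g then 1 else 0)"
    unfolding delta_one_def using g subgroup.mem_carrier[OF K]
    by (intro sum.cong refl) (auto, metis inv_equality inv_comm)
  also have "\<dots> = (if g \<in> K then 1 else 0)"
    using finite_subset[OF subgroup.subset[OF K] finite_carrier] g subgroup.m_inv_closed[OF K]
    by auto (metis inv_inv)
  finally show ?thesis by (simp add: uniform_def)
qed

lemma proj_support_subset: "proj_support G H \<subseteq> dual G"
  by (auto simp: proj_support_def)

lemma finite_proj_support: "finite (proj_support G H)"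
  using finite_subset[OF proj_support_subset finite_dual] .

lemma uniform_fourier_inv_support:
  assumes H: "subgroup H G" and K: "K \<in> conjugates G H" and g: "g \<in> carrier G"
  shows "uniform K g = fourier_inv (proj_support G H) (\<lambda>C. avg_rep C K) g"
proof -
  have sK: "subgroup K G" using K H by (auto simp: conjugates_def subgroup_conj_subgroup)
  have "coef C (avg_rep C K) g = 0" if "C \<in> dual G - proj_support G H" for C
  proof (rule coef_zero)
    have "coef C (avg_rep C K) \<one> = 0"
      using that proj_support_conj[OF H K] proj_support_iff[OF sK, of C] by auto
    then show "avg_rep C K i j = 0" if "i < rep_dim C" "j < rep_dim C" for i j
      using avg_rep_eq_zero_iff[OF _ sK, of C] \<open>C \<in> _\<close> that by blast
  qed
  then have "fourier_inv (dual G) (\<lambda>C. avg_rep C K) g = fourier_inv (proj_support G H) (\<lambda>C. avg_rep C K) g"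
    unfolding fourier_inv_def by (intro sum.mono_neutral_right finite_dual proj_support_subset) auto
  then show ?thesis using uniform_fourier_inv[OF sK g] by simp
qed

lemma avg_rep_conj_intertwine:
  assumes C: "C \<in> dual G" and K: "K \<subseteq> carrier G" and x: "x \<in> carrier G"
    and ij: "i < rep_dim C" "j < rep_dim C"
  shows "(\<Sum>m = 0..<rep_dim C. class_rep C x $$ (i, m) * avg_rep C (conj_subgroup G K x) m j)
      = (\<Sum>m = 0..<rep_dim C. avg_rep C K i m * class_rep C x $$ (m, j))"
proof -
  have Kg: "h \<in> carrier G" if "h \<in> K" for h using K that by blast
  have "(\<Sum>m = 0..<rep_dim C. class_rep C x $$ (i, m) * avg_rep C (conj_subgroup G K x) m j)
      = (\<Sum>h\<in>K. \<Sum>m = 0..<rep_dim C. class_rep C x $$ (i, m) * class_rep C (inv x \<otimes> h \<otimes> x) $$ (m, j)) / of_nat (card K)"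
    using K x unfolding avg_rep_def
    by (subst sum.swap) (simp add: card_conj_subgroup sum_conj_subgroup sum_distrib_left sum_divide_distrib)
  also have "(\<Sum>h\<in>K. \<Sum>m = 0..<rep_dim C. class_rep C x $$ (i, m) * class_rep C (inv x \<otimes> h \<otimes> x) $$ (m, j))
      = (\<Sum>h\<in>K. class_rep C (x \<otimes> (inv x \<otimes> h \<otimes> x)) $$ (i, j))"
    using ij Kg x by (intro sum.cong refl rep_mult_index[OF class_rep[OF C], symmetric]) auto
  also have "\<dots> = (\<Sum>h\<in>K. class_rep C (h \<otimes> x) $$ (i, j))"
    using Kg x by (intro sum.cong refl) (simp add: m_assoc[symmetric])
  also have "\<dots> = (\<Sum>h\<in>K. \<Sum>m = 0..<rep_dim C. class_rep C h $$ (i, m) * class_rep C x $$ (m, j))"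
    using ij Kg x by (intro sum.cong refl rep_mult_index[OF class_rep[OF C]]) auto
  also have "\<dots> / of_nat (card K) = (\<Sum>m = 0..<rep_dim C. avg_rep C K i m * class_rep C x $$ (m, j))"
    unfolding avg_rep_def
    by (subst sum.swap) (simp add: sum_distrib_right sum_divide_distrib)
  finally show ?thesis .
qed

text \<open>Conjugation permutes the summands, so their sum commutes with the representation and
  Schur's lemma applies. Traces give the value and its sign: all conjugates share the same positive
  \<open>t\<close>, and a scalar \<open>c\<close> contributes \<open>c\<close> times the squared
  dimension over the group order.\<close>

lemma sum_conjugates_avg_rep_scalar:
  assumes H: "subgroup H G" and C: "C \<in> proj_support G H"
  obtains \<mu> :: real where "0 < \<mu>"
    "\<And>i j. i < rep_dim C \<Longrightarrow> j < rep_dim C \<Longrightarrow>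
      (\<Sum>K\<in>conjugates G H. avg_rep C K i j) = of_real \<mu> * id_mat i j"
proof -
  let ?d = "rep_dim C" and ?n = "card (carrier G)"
  have Cd: "C \<in> dual G" and nz: "coef C (avg_rep C H) \<one> \<noteq> 0"
    using C proj_support_iff[OF H] by auto
  note Hc = subgroup.subset[OF H]
  define M where "M = mat ?d ?d (\<lambda>(i, j). \<Sum>K\<in>conjugates G H. avg_rep C K i j)"
  have M: "M \<in> carrier_mat ?d ?d" by (simp add: M_def)
  have "M * class_rep C x = class_rep C x * M" if x: "x \<in> carrier G" for x
  proof (rule eq_matI)
    note c = rep_carrier[OF class_rep[OF Cd] x]
    fix i j assume "i < dim_row (class_rep C x * M)" "j < dim_col (class_rep C x * M)"
    then have ij: "i < ?d" "j < ?d" using c M by auto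
    have "(M * class_rep C x) $$ (i, j)
        = (\<Sum>K\<in>conjugates G H. \<Sum>m = 0..<?d. avg_rep C K i m * class_rep C x $$ (m, j))"
      unfolding mult_mat_index_sum[OF M c ij] using ij
      by (subst sum.swap) (simp add: M_def sum_distrib_right)
    also have "\<dots> = (\<Sum>K\<in>conjugates G H. \<Sum>m = 0..<?d. class_rep C x $$ (i, m) * avg_rep C (conj_subgroup G K x) m j)"
      using subgroup.subset[OF subgroup_conj_subgroup[OF H]]
      by (intro sum.cong refl avg_rep_conj_intertwine[OF Cd _ x ij, symmetric]) (auto simp: conjugates_def)
    also have "\<dots> = (\<Sum>K\<in>conjugates G H. \<Sum>m = 0..<?d. class_rep C x $$ (i, m) * avg_rep C K m j)"
      by (rule sum_conjugates_conj[OF Hc x])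
    also have "\<dots> = (class_rep C x * M) $$ (i, j)"
      unfolding mult_mat_index_sum[OF c M ij] using ij
      by (subst sum.swap) (simp add: M_def sum_distrib_left)
    finally show "(M * class_rep C x) $$ (i, j) = (class_rep C x * M) $$ (i, j)" .
  qed (use M rep_carrier[OF class_rep[OF Cd] x] in auto)
  then obtain c where c: "M = c \<cdot>\<^sub>m 1\<^sub>m ?d" using schur_scalar[OF class_rep_irreps[OF Cd] M] by metis
  have entry: "(\<Sum>K\<in>conjugates G H. avg_rep C K i j) = c * id_mat i j" if ij: "i < ?d" "j < ?d" for i j
  proof -
    have "M $$ (i, j) = (c \<cdot>\<^sub>m 1\<^sub>m ?d) $$ (i, j)" by (simp only: c)
    then show ?thesis using ij by (simp add: M_def id_mat_def)
  qed
  obtain t where t: "coef C (avg_rep C H) \<one> = of_real t" "0 < t"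
    using coef_avg_rep_one_pos[OF Cd H nz] .
  have "c * of_real ((real ?d)\<^sup>2 / real ?n) = coef C (\<lambda>i j. c * id_mat i j) \<one>"
    by (simp add: coef_scale coef_id_one[OF Cd])
  also have "\<dots> = coef C (\<lambda>i j. \<Sum>K\<in>conjugates G H. avg_rep C K i j) \<one>"
    by (rule coef_cong) (simp add: entry)
  also have "\<dots> = (\<Sum>K\<in>conjugates G H. coef C (avg_rep C K) \<one>)" by (rule coef_sum)
  also have "\<dots> = (\<Sum>K\<in>conjugates G H. of_real t)"
    using coef_avg_rep_conj[OF Cd Hc] t(1) by (intro sum.cong refl) (auto simp: conjugates_def)
  finally have "c * of_real ((real ?d)\<^sup>2 / real ?n) = of_real (real (card (conjugates G H)) * t)" by simp
  moreover have pos: "0 < (real ?d)\<^sup>2 / real ?n" using rep_dim_pos[OF Cd] card_carrier_pos by simp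
  ultimately have "c = of_real (real (card (conjugates G H)) * t) / of_real ((real ?d)\<^sup>2 / real ?n)"
    by (metis less_irrefl nonzero_eq_divide_eq of_real_eq_0_iff)
  then have c: "c = of_real (real (card (conjugates G H)) * t / ((real ?d)\<^sup>2 / real ?n))"
    by (simp only: of_real_divide)
  have "0 < card (conjugates G H)"
    using finite_conjugates conjugates_refl[OF Hc] by (metis card_gt_0_iff empty_iff)
  then have "0 < real (card (conjugates G H)) * t / ((real ?d)\<^sup>2 / real ?n)"
    using pos t(2) by (intro divide_pos_pos[OF _ pos] mult_pos_pos) auto
  then show ?thesis using that entry c by metis
qed

lemma hermitian_cong:
  "(\<And>g. g \<in> carrier G \<Longrightarrow> u g = v g) \<Longrightarrow> hermitian u \<Longrightarrow> hermitian v"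
  by (simp add: hermitian_def)

lemma conv_cong:
  "g \<in> carrier G \<Longrightarrow> (\<And>x. x \<in> carrier G \<Longrightarrow> u x = u' x) \<Longrightarrow> (\<And>x. x \<in> carrier G \<Longrightarrow> v x = v' x) \<Longrightarrow>
    conv u v g = conv u' v' g"
  by (simp add: conv_def)

lemma hermitian_diff: "hermitian u \<Longrightarrow> hermitian v \<Longrightarrow> hermitian (\<lambda>g. u g - v g)"
  by (simp add: hermitian_def)

lemma hermitian_uniform:
  assumes K: "subgroup K G"
  shows "hermitian (uniform K)"
  using subgroup.m_inv_closed[OF K] unfolding hermitian_def uniform_def
  by (auto, metis inv_inv)

lemma hermitian_fourier_inv_id: "S \<subseteq> dual G \<Longrightarrow> hermitian (fourier_inv S (\<lambda>C. id_mat))"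
  unfolding fourier_inv_def using coef_id_inv by (intro hermitian_sum) auto

lemma idempotent_fourier_inv_id:
  "S \<subseteq> dual G \<Longrightarrow> idempotent (fourier_inv S (\<lambda>C. id_mat))"
  using finite_subset[OF _ finite_dual] by (intro fourier_inv_idempotent) (auto simp: mult_upto_id)

section \<open>Measurements\<close>

text \<open>These are the operators commuting with all left translations; the coset states are among
  them.\<close>

definition conv_oper :: "('a \<Rightarrow> complex) \<Rightarrow> 'a oper" where
  "conv_oper u x y = u (inv x \<otimes> y)"

text \<open>The left side is an entry of a product of two \<open>conv_oper\<close>, so operator
  products become convolutions.\<close>

lemma conv_translate:
  assumes "x \<in> carrier G" "y \<in> carrier G"
  shows "(\<Sum>z\<in>carrier G. u (inv x \<otimes> z) * v (inv z \<otimes> y)) = conv u v (inv x \<otimes> y)"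
proof -
  have "(\<Sum>z\<in>carrier G. u (inv x \<otimes> z) * v (inv z \<otimes> y))
      = (\<Sum>z\<in>carrier G. u (inv x \<otimes> (x \<otimes> z)) * v (inv (x \<otimes> z) \<otimes> y))"
    by (rule sum_mult_left[OF assms(1), symmetric])
  also have "\<dots> = conv u v (inv x \<otimes> y)"
    unfolding conv_def using assms
    by (intro sum.cong refl) (simp add: inv_mult_group m_assoc, simp add: m_assoc[symmetric])
  finally show ?thesis .
qed

text \<open>The sum is the trace of \<open>F\<close> times a projection. Writing the projection as
  its product with its adjoint turns it into the sum of the quadratic form of \<open>F\<close> over
  the columns of the projection, so no square root of \<open>F\<close> is needed.\<close>

lemma psd_trace_conv_oper:
  assumes F: "psd_oper G F" and h: "hermitian w" and i: "idempotent w"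
  shows "0 \<le> (\<Sum>x\<in>carrier G. \<Sum>z\<in>carrier G. F x z * w (inv z \<otimes> x))"
proof -
  have w: "w (inv z \<otimes> x) = (\<Sum>y\<in>carrier G. w (inv y \<otimes> x) * cnj (w (inv y \<otimes> z)))"
    if x: "x \<in> carrier G" and z: "z \<in> carrier G" for x z
  proof -
    have "w (inv z \<otimes> x) = conv w w (inv z \<otimes> x)"
      using i x z by (simp add: idempotent_def)
    also have "\<dots> = (\<Sum>y\<in>carrier G. w (inv z \<otimes> y) * w (inv y \<otimes> x))"
      by (rule conv_translate[OF z x, symmetric])
    also have "\<dots> = (\<Sum>y\<in>carrier G. w (inv y \<otimes> x) * cnj (w (inv y \<otimes> z)))"
    proof (rule sum.cong[OF refl])
      fix y assume y: "y \<in> carrier G"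
      have "w (inv (inv y \<otimes> z)) = cnj (w (inv y \<otimes> z))"
        using h y z by (simp add: hermitian_def)
      then show "w (inv z \<otimes> y) * w (inv y \<otimes> x) = w (inv y \<otimes> x) * cnj (w (inv y \<otimes> z))"
        using y z by (simp add: inv_mult_group)
    qed
    finally show ?thesis .
  qed
  have "(\<Sum>x\<in>carrier G. \<Sum>z\<in>carrier G. F x z * w (inv z \<otimes> x))
      = (\<Sum>x\<in>carrier G. \<Sum>z\<in>carrier G. \<Sum>y\<in>carrier G. cnj (cnj (w (inv y \<otimes> x))) * F x z * cnj (w (inv y \<otimes> z)))"
    by (intro sum.cong refl, subst w) (simp_all add: sum_distrib_left mult_ac)
  also have "\<dots> = (\<Sum>x\<in>carrier G. \<Sum>y\<in>carrier G. \<Sum>z\<in>carrier G. cnj (cnj (w (inv y \<otimes> x))) * F x z * cnj (w (inv y \<otimes> z)))"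
    by (rule sum.cong[OF refl]) (rule sum.swap)
  also have "\<dots> = (\<Sum>y\<in>carrier G. \<Sum>x\<in>carrier G. \<Sum>z\<in>carrier G. cnj (cnj (w (inv y \<otimes> x))) * F x z * cnj (w (inv y \<otimes> z)))"
    by (rule sum.swap)
  also have "0 \<le> \<dots>"
  proof (rule sum_nonneg)
    fix y
    show "0 \<le> (\<Sum>x\<in>carrier G. \<Sum>z\<in>carrier G. cnj (cnj (w (inv y \<otimes> x))) * F x z * cnj (w (inv y \<otimes> z)))"
      using F[unfolded psd_oper_def, rule_format, of "\<lambda>x. cnj (w (inv y \<otimes> x))"] .
  qed
  finally show ?thesis .
qed

text \<open>The quadratic form at \<open>v\<close> is the trace against the rank-one operator of
  \<open>v\<close>, which is itself positive semidefinite.\<close>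

lemma psd_conv_oper:
  assumes h: "hermitian u" and i: "idempotent u"
  shows "psd_oper G (conv_oper u)"
  unfolding psd_oper_def
proof
  fix v :: "'a ket"
  have "psd_oper G (\<lambda>x z. v x * cnj (v z))"
    unfolding psd_oper_def
  proof
    fix t :: "'a ket"
    have "(\<Sum>x\<in>carrier G. \<Sum>y\<in>carrier G. cnj (t x) * (v x * cnj (v y)) * t y)
        = (\<Sum>x\<in>carrier G. cnj (t x) * v x) * cnj (\<Sum>x\<in>carrier G. cnj (t x) * v x)"
      by (simp add: sum_product mult_ac) (rule sum.swap)
    also have "\<dots> = of_real ((cmod (\<Sum>x\<in>carrier G. cnj (t x) * v x))\<^sup>2)"
      by (simp only: complex_norm_square)
    also have "0 \<le> \<dots>" by (simp add: less_eq_complex_def)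
    finally show "0 \<le> (\<Sum>x\<in>carrier G. \<Sum>y\<in>carrier G. cnj (t x) * (v x * cnj (v y)) * t y)" .
  qed
  from psd_trace_conv_oper[OF this h i]
  have "0 \<le> (\<Sum>x\<in>carrier G. \<Sum>z\<in>carrier G. v x * cnj (v z) * u (inv z \<otimes> x))" .
  also have "\<dots> = (\<Sum>z\<in>carrier G. \<Sum>x\<in>carrier G. cnj (v z) * conv_oper u z x * v x)"
    by (subst sum.swap) (simp add: conv_oper_def mult_ac)
  finally show "0 \<le> (\<Sum>x\<in>carrier G. \<Sum>y\<in>carrier G. cnj (v x) * conv_oper u x y * v y)" .
qed

lemma psd_sum_scaled:
  assumes "finite I" and "\<And>i. i \<in> I \<Longrightarrow> 0 \<le> c i" and "\<And>i. i \<in> I \<Longrightarrow> psd_oper G (A i)"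
  shows "psd_oper G (\<lambda>x y. \<Sum>i\<in>I. of_real (c i) * A i x y)"
  unfolding psd_oper_def
proof
  fix v :: "'a ket"
  let ?q = "\<lambda>B. \<Sum>x\<in>carrier G. \<Sum>y\<in>carrier G. cnj (v x) * B x y * v y"
  have "?q (\<lambda>x y. \<Sum>i\<in>I. of_real (c i) * A i x y)
      = (\<Sum>x\<in>carrier G. \<Sum>i\<in>I. \<Sum>y\<in>carrier G. of_real (c i) * (cnj (v x) * A i x y * v y))"
    by (rule sum.cong[OF refl], subst sum.swap) (simp add: sum_distrib_left sum_distrib_right mult_ac)
  also have "\<dots> = (\<Sum>i\<in>I. of_real (c i) * ?q (A i))"
    by (subst sum.swap) (simp add: sum_distrib_left)
  also have "0 \<le> \<dots>"
  proof (rule sum_nonneg)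
    fix i assume i: "i \<in> I"
    have "0 \<le> ?q (A i)" using assms(3)[OF i] by (simp add: psd_oper_def)
    then show "0 \<le> of_real (c i) * ?q (A i)"
      using assms(2)[OF i] by (simp add: less_eq_complex_def)
  qed
  finally show "0 \<le> ?q (\<lambda>x y. \<Sum>i\<in>I. of_real (c i) * A i x y)" .
qed

text \<open>The kets at \<open>x\<close> and \<open>y\<close> are both nonzero exactly when
  \<open>inv c \<otimes> x\<close> and \<open>inv x \<otimes> y\<close> lie in \<open>K\<close>. As
  many \<open>c\<close> as \<open>K\<close> has elements satisfy the first condition, each
  contributing the reciprocal of that number.\<close>

lemma coset_state_eq:
  assumes K: "subgroup K G" and x: "x \<in> carrier G" and y: "y \<in> carrier G"
  shows "coset_state G K x y = of_nat (card K) / of_nat (card (carrier G)) * uniform K (inv x \<otimes> y)"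
proof -
  note Kc = subgroup.subset[OF K]
  have fK: "finite K" using finite_subset[OF Kc finite_carrier] .
  have ket: "coset_ket G c K z = (if inv c \<otimes> z \<in> K then 1 else 0) / of_real (sqrt (real (card K)))"
    if c: "c \<in> carrier G" and z: "z \<in> carrier G" for c z
  proof -
    have "(\<Sum>h\<in>K. basis_ket (c \<otimes> h) z) = (\<Sum>h\<in>K. if h = inv c \<otimes> z then 1 else 0)"
      unfolding basis_ket_def
    proof (rule sum.cong[OF refl])
      fix h assume "h \<in> K"
      then have "h \<in> carrier G" using Kc by blast
      then have "z = c \<otimes> h \<longleftrightarrow> h = inv c \<otimes> z" using c z by (metis inv_solve_left)
      then show "(if z = c \<otimes> h then 1 else 0) = (if h = inv c \<otimes> z then 1 else (0::complex))" by simp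
    qed
    then show ?thesis using fK by (simp add: coset_ket_def)
  qed
  have prod: "coset_ket G c K x * cnj (coset_ket G c K y)
      = (if inv c \<otimes> x \<in> K then if inv x \<otimes> y \<in> K then 1 / of_nat (card K) else 0 else 0)"
    if c: "c \<in> carrier G" for c
  proof -
    have "inv c \<otimes> x \<in> K \<Longrightarrow> inv c \<otimes> y \<in> K \<longleftrightarrow> inv x \<otimes> y \<in> K"
    proof -
      assume k: "inv c \<otimes> x \<in> K"
      have "x \<otimes> (inv x \<otimes> y) = y" "c \<otimes> (inv c \<otimes> y) = y"
        using c x y by (simp_all flip: m_assoc)
      then have "inv c \<otimes> y = (inv c \<otimes> x) \<otimes> (inv x \<otimes> y)"
        "inv x \<otimes> y = inv (inv c \<otimes> x) \<otimes> (inv c \<otimes> y)"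
        using c x y by (simp_all add: m_assoc inv_mult_group)
      then show ?thesis
        using subgroup.m_closed[OF K] subgroup.m_inv_closed[OF K] k by metis
    qed
    moreover have "complex_of_real (sqrt (real (card K))) * complex_of_real (sqrt (real (card K))) = of_nat (card K)"
      by (simp flip: of_real_mult)
    ultimately show ?thesis using ket[OF c x] ket[OF c y] by auto
  qed
  have "(\<Sum>c\<in>carrier G. coset_ket G c K x * cnj (coset_ket G c K y))
      = (\<Sum>c\<in>carrier G. if inv c \<otimes> x \<in> K then if inv x \<otimes> y \<in> K then 1 / of_nat (card K) else 0 else 0)"
    by (intro sum.cong refl prod)
  also have "\<dots> = (\<Sum>c\<in>carrier G. if c \<otimes> x \<in> K then if inv x \<otimes> y \<in> K then 1 / of_nat (card K) else 0 else 0)"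
    by (rule sum_inv)
  also have "\<dots> = (\<Sum>c\<in>carrier G. if c \<in> K then if inv x \<otimes> y \<in> K then 1 / of_nat (card K) else 0 else 0)"
    by (rule sum_mult_right[OF x])
  also have "\<dots> = (\<Sum>c\<in>K. if inv x \<otimes> y \<in> K then 1 / of_nat (card K) else 0)"
    using finite_carrier Kc by (simp add: sum.If_cases Int_absorb1)
  finally show ?thesis
    using card_subgroup_pos[OF K] by (simp add: coset_state_def uniform_def)
qed

lemma trace_coset_state:
  assumes K: "subgroup K G"
  shows "oper_trace G (oper_mult G A (coset_state G K)) =
     of_nat (card K) / of_nat (card (carrier G)) *
     (\<Sum>x\<in>carrier G. \<Sum>z\<in>carrier G. A x z * uniform K (inv z \<otimes> x))"
  unfolding oper_trace_def oper_mult_def sum_distrib_left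
  by (intro sum.cong refl) (simp add: coset_state_eq[OF K])

lemma trace_conv_oper:
  "(\<Sum>x\<in>carrier G. \<Sum>z\<in>carrier G. conv_oper u x z * v (inv z \<otimes> x)) = of_nat (card (carrier G)) * conv u v \<one>"
proof -
  have "(\<Sum>z\<in>carrier G. conv_oper u x z * v (inv z \<otimes> x)) = conv u v \<one>" if "x \<in> carrier G" for x
    unfolding conv_oper_def using conv_translate[OF that that, of u v] that by simp
  then show ?thesis by simp
qed

lemma planch_eq:
  assumes "S \<subseteq> dual G"
  shows "fourier_inv S (\<lambda>C. id_mat) \<one> = of_real (planch G S)"
  unfolding fourier_inv_def planch_def of_real_sum using assms by (intro sum.cong refl coef_id_one) auto

end

section \<open>Optimal measurement for the conjugates of a fixed subgroup\<close>

locale conjugate_identification = finite_group G for G (structure) +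
  fixes H :: "'a set"
  assumes H: "subgroup H G"
begin

abbreviation "S \<equiv> proj_support G H"
abbreviation "supp_proj \<equiv> fourier_inv S (\<lambda>C. id_mat)"

lemmas H_subset = subgroup.subset[OF H]

lemma conjugate_subgroup: "K \<in> conjugates G H \<Longrightarrow> subgroup K G"
  using H by (auto simp: conjugates_def subgroup_conj_subgroup)

lemma card_conjugate: "K \<in> conjugates G H \<Longrightarrow> card K = card H"
  using H_subset by (auto simp: conjugates_def card_conj_subgroup)

text \<open>All functions involved have explicit Fourier coefficients on the support, so the
  identities are checked block by block. The first two say that \<open>P\<^sub>K\<close> lies below
  \<open>\<Pi>\<close>.\<close>

lemma conv_uniform:
  assumes K: "K \<in> conjugates G H" and g: "g \<in> carrier G"
  shows "conv supp_proj (uniform K) g = uniform K g" "conv (uniform K) supp_proj g = uniform K g"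
    "conv (uniform K) (uniform K) g = uniform K g"
proof -
  let ?p = "fourier_inv S (\<lambda>C. avg_rep C K)"
  note p = uniform_fourier_inv_support[OF H K]
  note sK = conjugate_subgroup[OF K]
  have e: "fourier_inv S A g = uniform K g"
    if "\<And>C i j. C \<in> S \<Longrightarrow> i < rep_dim C \<Longrightarrow> j < rep_dim C \<Longrightarrow> A C i j = avg_rep C K i j" for A
    unfolding p[OF g] fourier_inv_def using that by (intro sum.cong refl coef_cong) auto
  have "conv supp_proj (uniform K) g = conv supp_proj ?p g" by (rule conv_cong[OF g]) (simp_all add: p)
  then show "conv supp_proj (uniform K) g = uniform K g"
    unfolding conv_fourier_inv[OF proj_support_subset finite_proj_support g]
    using e by (simp add: mult_upto_id)
  have "conv (uniform K) supp_proj g = conv ?p supp_proj g" by (rule conv_cong[OF g]) (simp_all add: p)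
  then show "conv (uniform K) supp_proj g = uniform K g"
    unfolding conv_fourier_inv[OF proj_support_subset finite_proj_support g]
    using e by (simp add: mult_upto_id)
  have "conv (uniform K) (uniform K) g = conv ?p ?p g" by (rule conv_cong[OF g]) (simp_all add: p)
  then show "conv (uniform K) (uniform K) g = uniform K g"
    unfolding conv_fourier_inv[OF proj_support_subset finite_proj_support g]
    using e avg_rep_absorb[OF _ sK sK subset_refl] proj_support_subset by (simp add: subset_iff)
qed

lemma success_prob_eq:
  "success_prob G H F = real (card H) / (real (card (conjugates G H)) * real (card (carrier G))) *
     (\<Sum>K\<in>conjugates G H. Re (\<Sum>x\<in>carrier G. \<Sum>z\<in>carrier G. F K x z * uniform K (inv z \<otimes> x)))"
proof -
  have "(of_nat (card H) / of_nat (card (carrier G)) :: complex)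
      = of_real (real (card H) / real (card (carrier G)))" by simp
  moreover have "Re (of_real r * z) = r * Re z" for r z by simp
  ultimately have "Re (oper_trace G (oper_mult G (F K) (coset_state G K)))
      = real (card H) / real (card (carrier G)) *
        Re (\<Sum>x\<in>carrier G. \<Sum>z\<in>carrier G. F K x z * uniform K (inv z \<otimes> x))"
    if "K \<in> conjugates G H" for K
    unfolding trace_coset_state[OF conjugate_subgroup[OF that]] card_conjugate[OF that] by (simp only:)
  then have "(\<Sum>K\<in>conjugates G H. Re (oper_trace G (oper_mult G (F K) (coset_state G K))))
      = real (card H) / real (card (carrier G)) *
        (\<Sum>K\<in>conjugates G H. Re (\<Sum>x\<in>carrier G. \<Sum>z\<in>carrier G. F K x z * uniform K (inv z \<otimes> x)))"
    unfolding sum_distrib_left by (rule sum.cong[OF refl])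
  moreover have "a / n * t / c = a / (c * n) * t" for a n t c :: real by simp
  ultimately show ?thesis unfolding success_prob_def by (simp only:)
qed

lemma success_prob_le:
  assumes F: "measurement G H F"
  shows "success_prob G H F \<le> real (card H) / real (card (conjugates G H)) * planch G S"
proof -
  let ?n = "card (carrier G)"
  obtain E where E: "psd_oper G E" and sumF: "\<And>x y. x \<in> carrier G \<Longrightarrow> y \<in> carrier G \<Longrightarrow>
      (\<Sum>K\<in>conjugates G H. F K x y) + E x y = (if x = y then 1 else 0)"
    and psdF: "\<And>K. K \<in> conjugates G H \<Longrightarrow> psd_oper G (F K)"
    using F unfolding measurement_def by blast
  let ?t = "\<lambda>A u. \<Sum>x\<in>carrier G. \<Sum>z\<in>carrier G. A x z * u (inv z \<otimes> x) :: complex"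
  have herm: "hermitian supp_proj" and idem: "idempotent supp_proj"
    using hermitian_fourier_inv_id idempotent_fourier_inv_id proj_support_subset by blast+
  have le: "Re (?t (F K) (uniform K)) \<le> Re (?t (F K) supp_proj)" if K: "K \<in> conjugates G H" for K
  proof -
    \<comment> \<open>\<open>?w\<close> represents \<open>\<Pi> - P\<^sub>K\<close>, a projection
      because \<open>P\<^sub>K\<close> lies below \<open>\<Pi>\<close>.\<close>
    let ?w = "\<lambda>g. supp_proj g - uniform K g"
    have "hermitian ?w" using herm hermitian_uniform[OF conjugate_subgroup[OF K]] by (rule hermitian_diff)
    moreover have "idempotent ?w"
      using idem unfolding idempotent_def
      by (simp add: conv_diff_left conv_diff_right conv_uniform[OF K])
    ultimately have "0 \<le> ?t (F K) ?w" by (rule psd_trace_conv_oper[OF psdF[OF K]])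
    moreover have "?t (F K) ?w = ?t (F K) supp_proj - ?t (F K) (uniform K)"
      by (simp add: right_diff_distrib sum_subtractf)
    ultimately show ?thesis by (simp add: less_eq_complex_def)
  qed
  have "(\<Sum>K\<in>conjugates G H. ?t (F K) supp_proj) + ?t E supp_proj
      = (\<Sum>x\<in>carrier G. \<Sum>z\<in>carrier G. ((\<Sum>K\<in>conjugates G H. F K x z) + E x z) * supp_proj (inv z \<otimes> x))"
  proof -
    have "(\<Sum>K\<in>conjugates G H. ?t (F K) supp_proj)
        = (\<Sum>x\<in>carrier G. \<Sum>K\<in>conjugates G H. \<Sum>z\<in>carrier G. F K x z * supp_proj (inv z \<otimes> x))"
      by (rule sum.swap)
    also have "\<dots> = (\<Sum>x\<in>carrier G. \<Sum>z\<in>carrier G. \<Sum>K\<in>conjugates G H. F K x z * supp_proj (inv z \<otimes> x))"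
      by (rule sum.cong[OF refl]) (rule sum.swap)
    finally show ?thesis by (simp add: distrib_right sum.distrib sum_distrib_right)
  qed
  also have "\<dots> = (\<Sum>x\<in>carrier G. \<Sum>z\<in>carrier G. if x = z then supp_proj \<one> else 0)"
    by (intro sum.cong refl) (simp add: sumF)
  also have "\<dots> = of_nat ?n * of_real (planch G S)"
    using finite_carrier planch_eq[OF proj_support_subset] by simp
  finally have "Re (\<Sum>K\<in>conjugates G H. ?t (F K) supp_proj) + Re (?t E supp_proj) = real ?n * planch G S"
    by (metis Re_complex_of_real of_real_mult of_real_of_nat_eq plus_complex.sel(1))
  moreover have "0 \<le> Re (?t E supp_proj)"
    using psd_trace_conv_oper[OF E herm idem] by (simp add: less_eq_complex_def)
  ultimately have "(\<Sum>K\<in>conjugates G H. Re (?t (F K) supp_proj)) \<le> real ?n * planch G S" by simp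
  moreover have "(\<Sum>K\<in>conjugates G H. Re (?t (F K) (uniform K)))
      \<le> (\<Sum>K\<in>conjugates G H. Re (?t (F K) supp_proj))"
    by (rule sum_mono) (rule le)
  ultimately have bound: "(\<Sum>K\<in>conjugates G H. Re (?t (F K) (uniform K))) \<le> real ?n * planch G S"
    by (rule order_trans[rotated])
  have "success_prob G H F \<le> real (card H) / (real (card (conjugates G H)) * real ?n) * (real ?n * planch G S)"
    unfolding success_prob_eq using bound by (intro mult_left_mono) auto
  then show ?thesis using card_carrier_pos by simp
qed

text \<open>
  The operators \<open>F K\<close> in the proof are \<open>M\<^sup>+ P\<^sub>K\<close> for the projections \<open>P\<^sub>K\<close> onto the right
  \<open>K\<close>-invariant functions and their sum \<open>M\<close>, which is the scalar \<open>\<mu> C\<close> on the block of \<open>C\<close>.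
\<close>

lemma optimal_measurement:
  obtains F where "measurement G H F"
    "success_prob G H F = real (card H) / real (card (conjugates G H)) * planch G S"
proof -
  have "\<forall>C\<in>S. \<exists>\<mu> :: real. 0 < \<mu> \<and> (\<forall>i<rep_dim C. \<forall>j<rep_dim C.
      (\<Sum>K\<in>conjugates G H. avg_rep C K i j) = of_real \<mu> * id_mat i j)"
    using sum_conjugates_avg_rep_scalar[OF H] by metis
  then obtain \<mu> :: "'a matrep set \<Rightarrow> real" where \<mu>: "\<And>C. C \<in> S \<Longrightarrow> 0 < \<mu> C"
    "\<And>C i j. C \<in> S \<Longrightarrow> i < rep_dim C \<Longrightarrow> j < rep_dim C \<Longrightarrow>
      (\<Sum>K\<in>conjugates G H. avg_rep C K i j) = of_real (\<mu> C) * id_mat i j"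
    by metis
  have Sd: "C \<in> dual G" if "C \<in> S" for C using that proj_support_subset by blast
  define A where "A K C i j = of_real (1 / \<mu> C) * avg_rep C K i j" for K C i j
  define \<phi> where "\<phi> K = fourier_inv S (A K)" for K
  define F where "F K = conv_oper (\<phi> K)" for K
  have \<phi>_eq: "\<phi> K g = (\<Sum>C\<in>S. of_real (1 / \<mu> C) * coef C (avg_rep C K) g)" for K g
    unfolding \<phi>_def fourier_inv_def A_def coef_scale ..
  have sum\<phi>: "(\<Sum>K\<in>conjugates G H. \<phi> K g) = supp_proj g" for g
  proof -
    have "(\<Sum>K\<in>conjugates G H. \<phi> K g)
        = (\<Sum>C\<in>S. of_real (1 / \<mu> C) * coef C (\<lambda>i j. \<Sum>K\<in>conjugates G H. avg_rep C K i j) g)"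
      unfolding \<phi>_eq by (subst sum.swap) (simp add: coef_sum sum_distrib_left)
    also have "\<dots> = (\<Sum>C\<in>S. of_real (1 / \<mu> C) * coef C (\<lambda>i j. of_real (\<mu> C) * id_mat i j) g)"
      by (intro sum.cong refl arg_cong[of _ _ "(*) _"] coef_cong \<mu>(2))
    also have "\<dots> = supp_proj g"
      unfolding coef_scale fourier_inv_def by (intro sum.cong refl) (use \<mu>(1) in fastforce)
    finally show ?thesis .
  qed
  have psd: "psd_oper G (F K)" if K: "K \<in> conjugates G H" for K
  proof -
    \<comment> \<open>On each block \<open>P\<^sub>K\<close> is again a projection, so
      \<open>F K\<close> is a combination of projections with positive weights.\<close>
    have "psd_oper G (\<lambda>x y. \<Sum>C\<in>S. of_real (1 / \<mu> C) * conv_oper (coef C (avg_rep C K)) x y)"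
      using \<mu>(1) Sd conjugate_subgroup[OF K]
      by (intro psd_sum_scaled finite_proj_support psd_conv_oper coef_avg_rep_hermitian coef_avg_rep_idempotent)
        (auto intro: less_imp_le)
    then show ?thesis by (simp add: F_def conv_oper_def[abs_def] \<phi>_eq)
  qed
  have "measurement G H F"
    unfolding measurement_def
  \<comment> \<open>The operators \<open>F K\<close> sum to \<open>\<Pi>\<close> only, so the extra
    outcome takes the projection onto the blocks outside the support.\<close>
  proof (intro conjI ballI psd exI[of _ "conv_oper (fourier_inv (dual G - S) (\<lambda>C. id_mat))"])
    show "psd_oper G (conv_oper (fourier_inv (dual G - S) (\<lambda>C. id_mat)))"
      by (intro psd_conv_oper hermitian_fourier_inv_id idempotent_fourier_inv_id) auto
    fix x y assume xy: "x \<in> carrier G" "y \<in> carrier G"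
    have "fourier_inv (dual G) (\<lambda>C. id_mat) g = fourier_inv (dual G - S) (\<lambda>C. id_mat) g + supp_proj g" for g
      unfolding fourier_inv_def by (rule sum.subset_diff[OF proj_support_subset finite_dual])
    moreover have "inv x \<otimes> y = \<one> \<longleftrightarrow> x = y"
      using xy by (metis inv_equality inv_inv inv_closed l_inv)
    ultimately show "(\<Sum>K\<in>conjugates G H. F K x y) + conv_oper (fourier_inv (dual G - S) (\<lambda>C. id_mat)) x y
        = (if x = y then 1 else 0)"
      using fourier_inv_id[of "inv x \<otimes> y"] xy
      by (simp add: F_def conv_oper_def sum\<phi> delta_one_def add.commute)
  qed
  moreover have "success_prob G H F = real (card H) / real (card (conjugates G H)) * planch G S"
  proof -
    \<comment> \<open>\<open>F K\<close> absorbs \<open>P\<^sub>K\<close>, so the traces to be added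
      are those of the \<open>F K\<close> themselves, and these sum to the trace of
      \<open>\<Pi>\<close>.\<close>
    have conv: "conv (\<phi> K) (uniform K) \<one> = \<phi> K \<one>" if K: "K \<in> conjugates G H" for K
    proof -
      have "conv (\<phi> K) (uniform K) \<one> = conv (\<phi> K) (fourier_inv S (\<lambda>C. avg_rep C K)) \<one>"
        by (rule conv_cong) (simp_all add: uniform_fourier_inv_support[OF H K])
      also have "\<dots> = fourier_inv S (\<lambda>C. mult_upto (rep_dim C) (avg_rep C K) (A K C)) \<one>"
        unfolding \<phi>_def by (rule conv_fourier_inv[OF proj_support_subset finite_proj_support]) simp
      also have "\<dots> = \<phi> K \<one>"
        unfolding \<phi>_def fourier_inv_def
      proof (intro sum.cong refl coef_cong)
        fix C i j assume C: "C \<in> S" and ij: "i < rep_dim C" "j < rep_dim C"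
        have "mult_upto (rep_dim C) (avg_rep C K) (A K C) i j
            = of_real (1 / \<mu> C) * mult_upto (rep_dim C) (avg_rep C K) (avg_rep C K) i j"
          unfolding mult_upto_def A_def sum_distrib_left by (intro sum.cong refl) simp
        then show "mult_upto (rep_dim C) (avg_rep C K) (A K C) i j = A K C i j"
          using avg_rep_absorb[OF Sd[OF C] _ _ subset_refl ij] conjugate_subgroup[OF K] by (simp add: A_def)
      qed
      finally show ?thesis .
    qed
    have "(\<Sum>K\<in>conjugates G H. Re (\<Sum>x\<in>carrier G. \<Sum>z\<in>carrier G. F K x z * uniform K (inv z \<otimes> x)))
        = (\<Sum>K\<in>conjugates G H. real (card (carrier G)) * Re (\<phi> K \<one>))"
      unfolding F_def trace_conv_oper by (intro sum.cong refl) (simp add: conv)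
    also have "\<dots> = real (card (carrier G)) * Re (\<Sum>K\<in>conjugates G H. \<phi> K \<one>)"
      by (simp add: sum_distrib_left)
    also have "\<dots> = real (card (carrier G)) * planch G S"
      unfolding sum\<phi> planch_eq[OF proj_support_subset] by simp
    finally show ?thesis unfolding success_prob_eq using card_carrier_pos by simp
  qed
  ultimately show ?thesis by (rule that)
qed

section \<open>The bound by the normal core\<close>

lemma normal_core_subset_conjugate: "K \<in> conjugates G H \<Longrightarrow> normal_core G H \<subseteq> K"
  by (auto simp: conjugates_def normal_core_def)

lemma subgroup_normal_core: "subgroup (normal_core G H) G"
  unfolding normal_core_def using subgroup_conj_subgroup[OF H]
  by (intro subgroups_Inter) auto

text \<open>On a block of the support, the average over the core absorbs into every conjugate's
  average; these add up to a nonzero scalar, so the core average is the identity there. Removing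
  these blocks from \<open>uniform ?N\<close> therefore leaves the hermitian idempotent
  \<open>?w\<close>, whose nonnegative value at the identity is the difference of the two
  sides.\<close>

lemma planch_proj_support_le: "planch G S \<le> 1 / real (card (normal_core G H))"
proof -
  let ?N = "normal_core G H"
  note N = subgroup_normal_core
  let ?w = "fourier_inv (dual G - S) (\<lambda>C. avg_rep C ?N)"
  have avg_id: "avg_rep C ?N i j = id_mat i j" if C: "C \<in> S" and ij: "i < rep_dim C" "j < rep_dim C" for C i j
  proof -
    have Cd: "C \<in> dual G" using C proj_support_subset by blast
    obtain \<mu> :: real where \<mu>: "0 < \<mu>" "\<And>i j. i < rep_dim C \<Longrightarrow> j < rep_dim C \<Longrightarrow>
        (\<Sum>K\<in>conjugates G H. avg_rep C K i j) = of_real \<mu> * id_mat i j"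
      using sum_conjugates_avg_rep_scalar[OF H C] by metis
    have "of_real \<mu> * id_mat i j = (\<Sum>K\<in>conjugates G H. mult_upto (rep_dim C) (avg_rep C ?N) (avg_rep C K) i j)"
      using avg_rep_absorb[OF Cd N _ normal_core_subset_conjugate ij] conjugate_subgroup \<mu>(2)[OF ij] by simp
    also have "\<dots> = mult_upto (rep_dim C) (avg_rep C ?N) (\<lambda>m j. \<Sum>K\<in>conjugates G H. avg_rep C K m j) i j"
      unfolding mult_upto_def by (subst sum.swap) (simp add: sum_distrib_left)
    also have "\<dots> = of_real \<mu> * mult_upto (rep_dim C) (avg_rep C ?N) id_mat i j"
      unfolding mult_upto_def sum_distrib_left[of "of_real \<mu>"]
      using ij by (intro sum.cong refl) (simp add: \<mu>(2))
    finally show ?thesis using \<mu>(1) ij by (simp add: mult_upto_id)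
  qed
  have w: "?w g = uniform ?N g - supp_proj g" if g: "g \<in> carrier G" for g
  proof -
    have "uniform ?N g = ?w g + fourier_inv S (\<lambda>C. avg_rep C ?N) g"
      unfolding uniform_fourier_inv[OF N g] fourier_inv_def
      by (rule sum.subset_diff[OF proj_support_subset finite_dual])
    also have "fourier_inv S (\<lambda>C. avg_rep C ?N) g = supp_proj g"
      unfolding fourier_inv_def using avg_id by (intro sum.cong refl coef_cong) auto
    finally show ?thesis by simp
  qed
  have "hermitian ?w"
    using hermitian_cong[OF w[symmetric] hermitian_diff[OF hermitian_uniform[OF N] hermitian_fourier_inv_id]]
      proj_support_subset by blast
  moreover have "idempotent ?w"
    using avg_rep_absorb[OF _ N N subset_refl] finite_dual by (intro fourier_inv_idempotent) auto
  ultimately have "?w \<one> = of_real (\<Sum>g\<in>carrier G. (cmod (?w g))\<^sup>2)" by (rule hermitian_idempotent_one)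
  moreover have "?w \<one> = of_real (1 / real (card ?N) - planch G S)"
    using w[of \<one>] planch_eq[OF proj_support_subset] subgroup.one_closed[OF N] by (simp add: uniform_def)
  ultimately have "1 / real (card ?N) - planch G S = (\<Sum>g\<in>carrier G. (cmod (?w g))\<^sup>2)"
    using of_real_eq_iff by metis
  moreover have "0 \<le> (\<Sum>g\<in>carrier G. (cmod (?w g))\<^sup>2)" by (intro sum_nonneg) auto
  ultimately show ?thesis by linarith
qed

end

theorem theorem4:
  fixes G :: "('a, 'b) monoid_scheme" and H :: "'a set"
  assumes "group G" and "finite (carrier G)" and "subgroup H G"
  shows "(\<exists>F. measurement G H F \<and> success_prob G H F = P_success G H) \<and>
    (\<forall>F. measurement G H F \<longrightarrow> success_prob G H F \<le> P_success G H) \<and>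
    P_success G H =
      real (card H) / real (card (conjugates G H)) * planch G (proj_support G H) \<and>
    real (card H) / real (card (conjugates G H)) * planch G (proj_support G H) \<le>
      real (card H) / (real (card (conjugates G H)) * real (card (normal_core G H)))"
proof -
  interpret conjugate_identification G H
    using assms by (intro conjugate_identification.intro finite_group.intro
        finite_group_axioms.intro conjugate_identification_axioms.intro)
  let ?p = "real (card H) / real (card (conjugates G H)) * planch G (proj_support G H)"
  obtain F where F: "measurement G H F" "success_prob G H F = ?p" by (rule optimal_measurement)
  \<comment> \<open>\<open>GREATEST\<close> denotes the maximum because the upper bound is attained
    by \<open>F\<close>.\<close>
  have "P_success G H = ?p"
    unfolding P_success_def
    by (rule Greatest_equality) (use F success_prob_le in auto)
  moreover have "?p \<le> real (card H) / real (card (conjugates G H)) * (1 / real (card (normal_core G H)))"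
    by (intro mult_left_mono planch_proj_support_le) simp
  ultimately show ?thesis using F success_prob_le by auto
qed

end
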